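(* Let $\mathcal{H}$ be an infinite dimensional complex Hilbert space and let $\Phi:\mathcal{B}(\mathcal{H})\to\mathcal{B}(\mathcal{H})$ be a surjective linear map. Then $\Phi$ preserves the extreme points of the unit ball of $\mathcal{B}(\mathcal{H})$ if and only if at least one of the following holds: (i) there are unitary operators $U,V\in\mathcal{B}(\mathcal{H})$ such that $\Phi(A)=UAV$ for all $A\in\mathcal{B}(\mathcal{H})$; (ii) there are antiunitary operators $U',V'$ on $\mathcal{H}$ such that $\Phi(A)=U'A^*V'$ for all $A\in\mathcal{B}(\mathcal{H})$.
   Context: $\mathcal{B}(\mathcal{H})$ is the algebra of all bounded (complex-)linear operators on $\mathcal{H}$ with the operator norm; $\mathcal{H}$ is not assumed separable. The unit ball of $\mathcal{B}(\mathcal{H})$ is $\{A\in\mathcal{B}(\mathcal{H}):\|A\|\le 1\}$. A linear map $\Phi:\mathcal{B}(\mathcal{H})\to\mathcal{B}(\mathcal{H})$ preserves the extreme points of the unit ball if $\Phi(A)$ is an extreme point of the unit ball whenever $A$ is one. No continuity or injectivity of $\Phi$ is assumed. An antiunitary operator on $\mathcal{H}$ is a conjugate-linear, norm-preserving bijection $\mathcal{H}\to\mathcal{H}$. *)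

theory Defs
  imports "HOL-Analysis.Analysis"
begin

class complex_vector = real_vector +
  fixes scaleC :: "complex \<Rightarrow> 'a \<Rightarrow> 'a"  (infixr \<open>*\<^sub>C\<close> 75)
  assumes scaleC_add_right: "a *\<^sub>C (x + y) = a *\<^sub>C x + a *\<^sub>C y"
    and scaleC_add_left: "(a + b) *\<^sub>C x = a *\<^sub>C x + b *\<^sub>C x"
    and scaleC_scaleC: "a *\<^sub>C b *\<^sub>C x = (a * b) *\<^sub>C x"
    and scaleC_one: "1 *\<^sub>C x = x"
    and scaleR_scaleC: "r *\<^sub>R x = complex_of_real r *\<^sub>C x"

global_interpretation complex_vector:
  vector_space "scaleC :: complex \<Rightarrow> 'a \<Rightarrow> 'a::complex_vector"
  by unfold_locales (rule scaleC_add_right scaleC_add_left scaleC_scaleC scaleC_one)+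

text \<open>The inner product is linear in the first and conjugate-linear in the second argument.\<close>

class complex_inner = complex_vector + real_normed_vector +
  fixes cinner :: "'a \<Rightarrow> 'a \<Rightarrow> complex"
  assumes cinner_commute: "cinner x y = cnj (cinner y x)"
    and cinner_add_left: "cinner (x + y) z = cinner x z + cinner y z"
    and cinner_scaleC_left: "cinner (a *\<^sub>C x) y = a * cinner x y"
    and cinner_self: "cinner x x = complex_of_real ((norm x)\<^sup>2)"

class complex_hilbert_space = complex_inner + complete_space

lemma norm_scaleC:
  fixes x :: "'a::complex_inner"
  shows "norm (a *\<^sub>C x) = cmod a * norm x"
proof -
  have "cinner (a *\<^sub>C x) (a *\<^sub>C x) = a * cnj a * cinner x x"
    by (metis cinner_commute cinner_scaleC_left complex_cnj_mult mult.assoc)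
  then have "complex_of_real ((norm (a *\<^sub>C x))\<^sup>2) = complex_of_real ((cmod a * norm x)\<^sup>2)"
    by (simp only: cinner_self complex_norm_square [symmetric] of_real_mult [symmetric]
        power_mult_distrib)
  then have "(norm (a *\<^sub>C x))\<^sup>2 = (cmod a * norm x)\<^sup>2"
    using of_real_eq_iff by blast
  then show ?thesis
    by (simp add: power2_eq_iff_nonneg)
qed

lemma bounded_linear_scaleC:
  "bounded_linear (scaleC a :: 'a \<Rightarrow> 'a::complex_inner)"
proof (rule bounded_linear_intro [where K = "cmod a"])
  show "a *\<^sub>C (x + y) = a *\<^sub>C x + a *\<^sub>C y" for x y :: 'a
    by (rule scaleC_add_right)
  show "a *\<^sub>C r *\<^sub>R x = r *\<^sub>R a *\<^sub>C x" for r and x :: 'a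
    by (simp add: scaleR_scaleC scaleC_scaleC mult.commute)
  show "norm (a *\<^sub>C x) \<le> norm x * cmod a" for x :: 'a
    by (simp add: norm_scaleC)
qed

typedef (overloaded) 'a bop =
  "{A :: 'a::complex_inner \<Rightarrow>\<^sub>L 'a. \<forall>c x. A (c *\<^sub>C x) = c *\<^sub>C A x}"
  by (rule exI [of _ 0]) simp

setup_lifting type_definition_bop

text \<open>All structure is inherited from the bounded real-linear maps; in particular the norm is the
  operator norm.\<close>

instantiation bop :: (complex_inner) real_normed_vector
begin

lift_definition zero_bop :: "'a bop" is 0 by simp

lift_definition plus_bop :: "'a bop \<Rightarrow> 'a bop \<Rightarrow> 'a bop" is "(+)"
  by (simp add: blinfun.add_left scaleC_add_right)

lift_definition minus_bop :: "'a bop \<Rightarrow> 'a bop \<Rightarrow> 'a bop" is "(-)"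
  by (simp add: blinfun.diff_left complex_vector.scale_right_diff_distrib)

lift_definition uminus_bop :: "'a bop \<Rightarrow> 'a bop" is uminus
  by (simp add: blinfun.minus_left)

lift_definition scaleR_bop :: "real \<Rightarrow> 'a bop \<Rightarrow> 'a bop" is "(*\<^sub>R)"
  by (simp add: blinfun.scaleR_left scaleR_scaleC scaleC_scaleC mult.commute)

lift_definition norm_bop :: "'a bop \<Rightarrow> real" is norm .

definition sgn_bop :: "'a bop \<Rightarrow> 'a bop" where "sgn_bop A = scaleR (inverse (norm A)) A"

definition dist_bop :: "'a bop \<Rightarrow> 'a bop \<Rightarrow> real" where "dist_bop A B = norm (A - B)"

definition uniformity_bop :: "('a bop \<times> 'a bop) filter" where
  "uniformity_bop = (INF e\<in>{0 <..}. principal {(A, B). dist A B < e})"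

definition open_bop :: "'a bop set \<Rightarrow> bool" where
  "open_bop S = (\<forall>A\<in>S. \<forall>\<^sub>F (A', B) in uniformity. A' = A \<longrightarrow> B \<in> S)"

instance
  by standard
    ((simp only: sgn_bop_def dist_bop_def uniformity_bop_def open_bop_def; fail)
      | (transfer; simp add: algebra_simps norm_triangle_ineq; fail))+

end

instantiation bop :: (complex_inner) complex_vector
begin

lift_definition scaleC_bop :: "complex \<Rightarrow> 'a bop \<Rightarrow> 'a bop" is
  "\<lambda>a A. Blinfun (scaleC a) o\<^sub>L A"
  by (simp add: bounded_linear_Blinfun_apply bounded_linear_scaleC scaleC_scaleC mult.commute)

instance
proof
  fix a b :: complex and r :: real and A B :: "'a bop"
  note [simp] = bounded_linear_Blinfun_apply bounded_linear_scaleC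
  show "a *\<^sub>C (A + B) = a *\<^sub>C A + a *\<^sub>C B"
    by transfer (auto intro!: blinfun_eqI simp: blinfun.add_left scaleC_add_right)
  show "(a + b) *\<^sub>C A = a *\<^sub>C A + b *\<^sub>C A"
    by transfer (auto intro!: blinfun_eqI simp: blinfun.add_left scaleC_add_left)
  show "a *\<^sub>C b *\<^sub>C A = (a * b) *\<^sub>C A"
    by transfer (auto intro!: blinfun_eqI simp: scaleC_scaleC)
  show "1 *\<^sub>C A = A"
    by transfer (auto intro!: blinfun_eqI simp: scaleC_one)
  show "r *\<^sub>R A = complex_of_real r *\<^sub>C A"
    by transfer (auto intro!: blinfun_eqI simp: blinfun.scaleR_left scaleR_scaleC)
qed

end

lift_definition bop_apply :: "'a::complex_inner bop \<Rightarrow> 'a \<Rightarrow> 'a" is blinfun_apply .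

lift_definition bop_id :: "'a::complex_inner bop" is id_blinfun by simp

lift_definition bop_comp :: "'a::complex_inner bop \<Rightarrow> 'a bop \<Rightarrow> 'a bop"  (infixl \<open>\<circ>\<^sub>B\<close> 70)
  is blinfun_compose by simp

text \<open>Existence and uniqueness of the adjoint on a Hilbert space follow from the Riesz
  representation theorem.\<close>

definition adj :: "'a::complex_hilbert_space bop \<Rightarrow> 'a bop"  (\<open>_\<^sup>*\<close> [1000] 999) where
  "A\<^sup>* = (THE B. \<forall>x y. cinner (bop_apply A x) y = cinner x (bop_apply B y))"

definition unitary :: "'a::complex_hilbert_space bop \<Rightarrow> bool" where
  "unitary U \<longleftrightarrow> U\<^sup>* \<circ>\<^sub>B U = bop_id \<and> U \<circ>\<^sub>B U\<^sup>* = bop_id"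

definition antiunitary :: "('a::complex_inner \<Rightarrow> 'a) \<Rightarrow> bool" where
  "antiunitary f \<longleftrightarrow>
    (\<forall>x y. f (x + y) = f x + f y) \<and> (\<forall>a x. f (a *\<^sub>C x) = cnj a *\<^sub>C f x) \<and>
    (\<forall>x. norm (f x) = norm x) \<and> bij f"

definition preserves_extreme_points ::
    "('a::complex_inner bop \<Rightarrow> 'a bop) \<Rightarrow> bool" where
  "preserves_extreme_points \<Phi> \<longleftrightarrow>
    (\<forall>A. A extreme_point_of {B. norm B \<le> 1} \<longrightarrow> \<Phi> A extreme_point_of {B. norm B \<le> 1})"

end

theory Submission imports Defs begin

text \<open>By Kadison's theorem the extreme points of the unit ball are the isometries and the coisometries.
  Suppose \<open>\<Phi>\<close> preserves them. If \<open>X\<close> and \<open>Y\<close> are isometries with orthogonal ranges, then every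
  \<open>X + zY\<close> with \<open>\<bar>z\<bar> = 1\<close> is a multiple of an isometry, so \<open>\<Phi> X\<close> and \<open>\<Phi> Y\<close> are either isometries
  with orthogonal ranges or coisometries with orthogonal initial spaces. Writing \<open>1 = SS\<^sup>* + TT\<^sup>*\<close>
  with isometries \<open>S\<close> and \<open>T\<close>, and using that the unitary operators span all operators, one gets
  \<open>(\<Phi> X)\<^sup>* (\<Phi> Y) = (\<Phi> 1)\<^sup>* \<Phi>(X\<^sup>*Y)\<close>, possibly after composing \<open>\<Phi>\<close> with the adjoint; hence linear and
  conjugate-linear maps are treated together. The same argument for \<open>X \<mapsto> \<Phi>(X\<^sup>*)\<close> shows that
  \<open>W = \<Phi> 1\<close> is unitary, so that \<open>\<pi> = W\<^sup>* \<Phi>\<close> is a surjective star-homomorphism. It is spatial: a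
  projection of rank one lifts to a projection \<open>Q\<close>, and \<open>Q\<close> cannot have infinite rank, since it would
  be a sum of two equivalent projections. Hence \<open>\<pi>\<close> does not vanish on some \<open>f \<otimes> f\<close>, and
  \<open>x \<mapsto> \<pi>(x \<otimes> f) g\<close>, with \<open>g\<close> in the range of \<open>\<pi>(f \<otimes> f)\<close>, implements \<open>\<pi>\<close>.\<close>

instance complex_hilbert_space \<subseteq> banach ..

unbundle no rtrancl_syntax

notation cinner (\<open>\<langle>_, _\<rangle>\<close>)
notation bop_apply (infixr \<open>\<cdot>\<close> 90)

subsection \<open>Inner product spaces\<close>

lemma cinner_add_right: "\<langle>x, y + z\<rangle> = \<langle>x, y\<rangle> + \<langle>x, z\<rangle>"
  by (metis cinner_add_left cinner_commute complex_cnj_add)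

lemma cinner_scaleC_right: "\<langle>x, a *\<^sub>C y\<rangle> = cnj a * \<langle>x, y\<rangle>"
  by (metis cinner_commute cinner_scaleC_left complex_cnj_mult)

lemma cinner_zero_left [simp]: "\<langle>0, y\<rangle> = 0"
  using cinner_add_left [of 0 0 y] by simp

lemma cinner_zero_right [simp]: "\<langle>x, 0\<rangle> = 0"
  using cinner_add_right [of x 0 0] by simp

lemma cinner_minus_left: "\<langle>- x, y\<rangle> = - \<langle>x, y\<rangle>"
  using cinner_add_left [of x "- x" y] by (simp add: eq_neg_iff_add_eq_0 add.commute)

lemma cinner_minus_right: "\<langle>x, - y\<rangle> = - \<langle>x, y\<rangle>"
  using cinner_add_right [of x y "- y"] by (simp add: eq_neg_iff_add_eq_0 add.commute)

lemma cinner_diff_left: "\<langle>x - y, z\<rangle> = \<langle>x, z\<rangle> - \<langle>y, z\<rangle>"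
  using cinner_add_left [of x "- y" z] by (simp add: cinner_minus_left)

lemma cinner_diff_right: "\<langle>x, y - z\<rangle> = \<langle>x, y\<rangle> - \<langle>x, z\<rangle>"
  using cinner_add_right [of x y "- z"] by (simp add: cinner_minus_right)

lemma cinner_scaleR_left: "\<langle>r *\<^sub>R x, y\<rangle> = of_real r * \<langle>x, y\<rangle>"
  by (simp add: scaleR_scaleC cinner_scaleC_left)

lemma cinner_scaleR_right: "\<langle>x, r *\<^sub>R y\<rangle> = of_real r * \<langle>x, y\<rangle>"
  by (simp add: scaleR_scaleC cinner_scaleC_right)

lemmas cinner_simps = cinner_add_left cinner_add_right cinner_diff_left cinner_diff_right
  cinner_minus_left cinner_minus_right cinner_scaleC_left cinner_scaleC_right
  cinner_scaleR_left cinner_scaleR_right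

lemma cinner_sum_left: "\<langle>\<Sum>i\<in>I. f i, y\<rangle> = (\<Sum>i\<in>I. \<langle>f i, y\<rangle>)"
  by (induction I rule: infinite_finite_induct) (auto simp: cinner_add_left)

lemma cinner_sum_right: "\<langle>x, \<Sum>i\<in>I. f i\<rangle> = (\<Sum>i\<in>I. \<langle>x, f i\<rangle>)"
  by (induction I rule: infinite_finite_induct) (auto simp: cinner_add_right)

lemma cinner_eq_zero_sym: "\<langle>x, y\<rangle> = 0 \<longleftrightarrow> \<langle>y, x\<rangle> = 0"
  by (metis cinner_commute complex_cnj_zero_iff)

lemma cinner_self_eq_zero_iff [simp]: "\<langle>x, x\<rangle> = 0 \<longleftrightarrow> x = 0"
  by (simp add: cinner_self)

lemma cinner_ext: "(\<And>y. \<langle>x, y\<rangle> = \<langle>x', y\<rangle>) \<Longrightarrow> x = x'"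
  by (metis cinner_diff_left cinner_self_eq_zero_iff right_minus_eq)

lemma cinner_ext_right: "(\<And>y. \<langle>y, x\<rangle> = \<langle>y, x'\<rangle>) \<Longrightarrow> x = x'"
  by (metis cinner_diff_right cinner_self_eq_zero_iff right_minus_eq)

lemma norm_add_square: "(norm (x + y))\<^sup>2 = (norm x)\<^sup>2 + (norm y)\<^sup>2 + 2 * Re \<langle>x, y\<rangle>"
  for x y :: "'a::complex_inner"
proof -
  have "complex_of_real ((norm (x + y))\<^sup>2) = \<langle>x, x\<rangle> + \<langle>y, y\<rangle> + (\<langle>x, y\<rangle> + cnj \<langle>x, y\<rangle>)"
    using cinner_commute [of y x] by (simp only: flip: cinner_self) (simp add: cinner_simps)
  also have "\<dots> = complex_of_real ((norm x)\<^sup>2 + (norm y)\<^sup>2 + 2 * Re \<langle>x, y\<rangle>)"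
    by (simp add: cinner_self complex_add_cnj)
  finally show ?thesis
    using of_real_eq_iff by blast
qed

lemma norm_diff_square: "(norm (x - y))\<^sup>2 = (norm x)\<^sup>2 + (norm y)\<^sup>2 - 2 * Re \<langle>x, y\<rangle>"
  for x y :: "'a::complex_inner"
  using norm_add_square [of x "- y"] by (simp add: cinner_simps)

lemma parallelogram_law:
  "(norm (x + y))\<^sup>2 + (norm (x - y))\<^sup>2 = 2 * (norm x)\<^sup>2 + 2 * (norm y)\<^sup>2"
  for x y :: "'a::complex_inner"
  by (simp add: norm_add_square norm_diff_square)

text \<open>Pythagoras after removing from \<open>x\<close> its component along \<open>y\<close>. It
  yields Cauchy-Schwarz, the orthogonality of nearest points and the estimate for rank-one
  perturbations.\<close>

lemma norm_diff_component:
  fixes x y :: "'a::complex_inner"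
  assumes "y \<noteq> 0"
  shows "(norm (x - (\<langle>x, y\<rangle> / of_real ((norm y)\<^sup>2)) *\<^sub>C y))\<^sup>2
    = (norm x)\<^sup>2 - (cmod \<langle>x, y\<rangle>)\<^sup>2 / (norm y)\<^sup>2"
proof -
  define a where "a = \<langle>x, y\<rangle> / of_real ((norm y)\<^sup>2)"
  have "(norm (x - a *\<^sub>C y))\<^sup>2 = (norm x)\<^sup>2 + (cmod a * norm y)\<^sup>2 - 2 * Re (cnj a * \<langle>x, y\<rangle>)"
    by (simp add: norm_diff_square norm_scaleC cinner_scaleC_right)
  moreover have "Re (cnj a * \<langle>x, y\<rangle>) = (cmod \<langle>x, y\<rangle>)\<^sup>2 / (norm y)\<^sup>2"
    by (simp add: a_def mult.commute [of "cnj _"] flip: complex_norm_square of_real_power of_real_divide)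
  moreover have "(cmod a * norm y)\<^sup>2 = (cmod \<langle>x, y\<rangle>)\<^sup>2 / (norm y)\<^sup>2"
    using assms by (simp add: a_def norm_divide power_mult_distrib power_divide norm_power)
      (simp add: field_simps power2_eq_square power4_eq_xxxx)
  ultimately show ?thesis unfolding a_def by linarith
qed

lemma cinner_Cauchy_Schwarz: "cmod \<langle>x, y\<rangle> \<le> norm x * norm y"
proof (cases "y = 0")
  case False
  have "(cmod \<langle>x, y\<rangle>)\<^sup>2 / (norm y)\<^sup>2 \<le> (norm x)\<^sup>2"
    using norm_diff_component [OF False, of x] zero_le_power2 [of "norm (x - _)"] by (metis diff_ge_0_iff_ge)
  then have "(cmod \<langle>x, y\<rangle>)\<^sup>2 \<le> (norm x * norm y)\<^sup>2"
    using False by (simp add: pos_divide_le_eq power_mult_distrib)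
  then show ?thesis
    by (rule power2_le_imp_le) simp
qed simp

lemma bounded_linear_cinner_left: "bounded_linear (\<lambda>x. \<langle>x, y\<rangle>)"
  by (rule bounded_linear_intro [where K = "norm y"])
    (simp_all add: cinner_simps cinner_Cauchy_Schwarz scaleR_conv_of_real)

lemma norm_of_unit_phase: "cmod z = 1 \<Longrightarrow> z * cnj z = 1"
  using complex_norm_square [of z] by simp

subsection \<open>Orthogonal projections and the Riesz representation theorem\<close>

text \<open>A minimizing sequence for the distance from \<open>x\<close> to \<open>K\<close> is
  Cauchy by the parallelogram law; minimality at its limit forces orthogonality.\<close>

lemma orthogonal_decomposition:
  fixes K :: "'a::complex_hilbert_space set"
  assumes K: "complex_vector.subspace K" and "closed K"
  obtains k where "k \<in> K" "\<And>y. y \<in> K \<Longrightarrow> \<langle>x - k, y\<rangle> = 0"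
proof -
  have K0: "0 \<in> K" by (rule complex_vector.subspace_0 [OF K])
  define d where "d = infdist x K"
  have d: "d \<le> norm (x - k)" if "k \<in> K" for k
    using infdist_le [OF that, of x] by (simp add: d_def dist_norm)
  have d0: "0 \<le> d" by (simp add: d_def infdist_nonneg)
  have "\<exists>k\<in>K. norm (x - k) < d + inverse (Suc n)" for n
  proof (rule ccontr)
    assume "\<not> ?thesis"
    then have "d + inverse (Suc n) \<le> (INF k\<in>K. dist x k)"
      using K0 by (intro cINF_greatest) (auto simp: not_less dist_norm)
    also have "\<dots> = d"
      using K0 by (auto simp: d_def infdist_def)
    finally have "d + inverse (Suc n) \<le> d" .
    then show False by simp
  qed
  then obtain k where kK: "\<And>n. k n \<in> K" and k: "\<And>n. norm (x - k n) < d + inverse (Suc n)"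
    by metis
  define t where "t n = (d + inverse (Suc n))\<^sup>2 - d\<^sup>2" for n
  have lim: "t \<longlonglongrightarrow> 0"
    using tendsto_diff [OF tendsto_power [OF tendsto_add [OF tendsto_const LIMSEQ_inverse_real_of_nat],
          of d 2] tendsto_const [of "d\<^sup>2"]] by (simp add: t_def [abs_def])
  have kt: "(norm (x - k n))\<^sup>2 \<le> d\<^sup>2 + t n" for n
    unfolding t_def using power_mono [OF less_imp_le [OF k [of n]], of 2] by simp
  \<comment> \<open>The midpoint of \<open>k m\<close> and \<open>k n\<close> lies in
    \<open>K\<close>, hence at distance at least \<open>d\<close> from \<open>x\<close>.\<close>
  have est: "(norm (k m - k n))\<^sup>2 \<le> 2 * t m + 2 * t n" for m n
  proof -
    have "(1/2) *\<^sub>R (k m + k n) \<in> K"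
      using kK K by (simp add: scaleR_scaleC complex_vector.subspace_add complex_vector.subspace_scale)
    from d [OF this] have "2 * d \<le> norm (2 *\<^sub>R (x - (1/2) *\<^sub>R (k m + k n)))"
      by (simp only: norm_scaleR)
    also have "2 *\<^sub>R (x - (1/2) *\<^sub>R (k m + k n)) = (x - k m) + (x - k n)"
      by (simp add: algebra_simps scaleR_2)
    finally have "4 * d\<^sup>2 \<le> (norm ((x - k m) + (x - k n)))\<^sup>2"
      using power_mono [of "2 * d" _ 2] d0 by (simp add: power_mult_distrib)
    moreover have "(norm ((x - k m) + (x - k n)))\<^sup>2 + (norm (k m - k n))\<^sup>2
        = 2 * (norm (x - k m))\<^sup>2 + 2 * (norm (x - k n))\<^sup>2"
      using parallelogram_law [of "x - k m" "x - k n"] by (simp add: norm_minus_commute)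
    ultimately show ?thesis using kt [of m] kt [of n] by linarith
  qed
  have "Cauchy k"
  proof (rule CauchyI)
    fix e :: real assume "0 < e"
    then have "\<forall>\<^sub>F n in sequentially. t n < e\<^sup>2 / 4"
      by (intro order_tendstoD [OF lim]) simp
    then obtain N where N: "\<And>n. n \<ge> N \<Longrightarrow> t n < e\<^sup>2 / 4"
      by (auto simp: eventually_sequentially)
    show "\<exists>N. \<forall>m\<ge>N. \<forall>n\<ge>N. norm (k m - k n) < e"
    proof (intro exI allI impI)
      fix m n assume "N \<le> m" "N \<le> n"
      have "(norm (k m - k n))\<^sup>2 < e\<^sup>2"
        using est [of m n] N [OF \<open>N \<le> m\<close>] N [OF \<open>N \<le> n\<close>] by linarith
      then show "norm (k m - k n) < e"
        using \<open>0 < e\<close> by (rule power_less_imp_less_base [OF _ less_imp_le])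
    qed
  qed
  then obtain l where l: "k \<longlonglongrightarrow> l"
    using Cauchy_convergent convergentD by blast
  have lK: "l \<in> K"
    using \<open>closed K\<close> kK l closed_sequentially by blast
  have "(\<lambda>n. (norm (x - k n))\<^sup>2) \<longlonglongrightarrow> (norm (x - l))\<^sup>2" "(\<lambda>n. d\<^sup>2 + t n) \<longlonglongrightarrow> d\<^sup>2 + 0"
    by (intro tendsto_intros l lim)+
  then have "(norm (x - l))\<^sup>2 \<le> d\<^sup>2 + 0"
    using kt by (intro LIMSEQ_le) auto
  then have ld: "norm (x - l) \<le> d"
    by (intro power2_le_imp_le [OF _ d0]) simp
  have "\<langle>x - l, y\<rangle> = 0" if y: "y \<in> K" for y
  proof (cases "y = 0")
    case False
    \<comment> \<open>Moving \<open>l\<close> by the component of \<open>x - l\<close> along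
      \<open>y\<close> would shorten the distance unless that component vanishes.\<close>
    define a where "a = \<langle>x - l, y\<rangle> / of_real ((norm y)\<^sup>2)"
    have "l + a *\<^sub>C y \<in> K"
      using K lK y by (simp add: complex_vector.subspace_add complex_vector.subspace_scale)
    from d [OF this] ld have "norm (x - l) \<le> norm ((x - l) - a *\<^sub>C y)"
      by (simp add: algebra_simps)
    then have "(norm (x - l))\<^sup>2 \<le> (norm ((x - l) - a *\<^sub>C y))\<^sup>2"
      by (intro power_mono) auto
    also have "\<dots> = (norm (x - l))\<^sup>2 - (cmod \<langle>x - l, y\<rangle>)\<^sup>2 / (norm y)\<^sup>2"
      unfolding a_def by (rule norm_diff_component [OF False])
    finally have "(cmod \<langle>x - l, y\<rangle>)\<^sup>2 / (norm y)\<^sup>2 \<le> 0" by simp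
    then show ?thesis using False by (simp add: divide_le_0_iff)
  qed simp
  with lK that show ?thesis by blast
qed

lemma Riesz_representation:
  fixes f :: "'a::complex_hilbert_space \<Rightarrow> complex"
  assumes f: "bounded_linear f" and fC: "\<And>c x. f (c *\<^sub>C x) = c * f x"
  obtains y where "\<And>x. f x = \<langle>x, y\<rangle>"
proof -
  interpret f: bounded_linear f by (rule f)
  define K where "K = {x. f x = 0}"
  have K: "complex_vector.subspace K"
    by (auto simp: K_def complex_vector.subspace_def f.add fC f.zero)
  have "closed K"
    unfolding K_def by (intro closed_Collect_eq f.continuous_on continuous_intros)
  show ?thesis
  proof (cases "\<forall>x. f x = 0")
    case True
    then show ?thesis by (intro that [of 0]) simp
  next
    case False
    then obtain u where u: "f u \<noteq> 0" by blast
    obtain k where k: "k \<in> K" "\<And>y. y \<in> K \<Longrightarrow> \<langle>u - k, y\<rangle> = 0"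
      using orthogonal_decomposition [OF K \<open>closed K\<close>] by blast
    \<comment> \<open>\<open>w\<close> spans the orthogonal complement of the kernel of
      \<open>f\<close>, so the representing vector is sought among its multiples.\<close>
    define w where "w = u - k"
    have fw: "f w \<noteq> 0" using u k(1) by (simp add: w_def f.diff K_def)
    then have w0: "w \<noteq> 0" by (auto simp: f.zero)
    show ?thesis
    proof (rule that)
      fix x
      have "x - (f x / f w) *\<^sub>C w \<in> K"
        using fw by (simp add: K_def f.diff fC)
      then have "\<langle>x - (f x / f w) *\<^sub>C w, w\<rangle> = 0"
        using k(2) cinner_eq_zero_sym w_def by blast
      then have "f x / f w * \<langle>w, w\<rangle> = \<langle>x, w\<rangle>"
        by (simp add: cinner_simps)
      then have "f x = f w / \<langle>w, w\<rangle> * \<langle>x, w\<rangle>"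
        using fw w0 by (simp add: field_simps)
      then show "f x = \<langle>x, cnj (f w / \<langle>w, w\<rangle>) *\<^sub>C w\<rangle>"
        by (simp add: cinner_scaleC_right)
    qed
  qed
qed

subsection \<open>The algebra of bounded operators\<close>

lemma bop_eqI: "(\<And>x. A \<cdot> x = B \<cdot> x) \<Longrightarrow> A = B"
  by transfer (auto intro: blinfun_eqI)

text \<open>These classes make the algebraic simplification rules available. On the zero space
  \<open>1 = 0\<close>, so \<open>real_normed_algebra_1\<close> would fail.\<close>

instantiation bop :: (complex_inner) "{real_normed_algebra, monoid_mult}"
begin

definition one_bop :: "'a bop" where "one_bop = bop_id"

definition times_bop :: "'a bop \<Rightarrow> 'a bop \<Rightarrow> 'a bop" where "times_bop = (\<circ>\<^sub>B)"

instance
  by standard (unfold times_bop_def one_bop_def; transfer;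
    auto intro!: blinfun_eqI simp: blinfun.bilinear_simps norm_blinfun_compose)+

end

lemma bop_comp_eq_times: "A \<circ>\<^sub>B B = A * B"
  by (simp add: times_bop_def)

lemma bop_apply_simps [simp]:
  "0 \<cdot> x = 0" "1 \<cdot> x = x" "(A + B) \<cdot> x = A \<cdot> x + B \<cdot> x" "(A - B) \<cdot> x = A \<cdot> x - B \<cdot> x"
  "(- A) \<cdot> x = - (A \<cdot> x)" "(r *\<^sub>R A) \<cdot> x = r *\<^sub>R (A \<cdot> x)" "(A * B) \<cdot> x = A \<cdot> (B \<cdot> x)"
  unfolding one_bop_def times_bop_def by (transfer; simp add: blinfun.bilinear_simps)+

lemma bop_apply_scaleC_left [simp]: "(a *\<^sub>C A) \<cdot> x = a *\<^sub>C (A \<cdot> x)"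
  by transfer (simp add: bounded_linear_Blinfun_apply bounded_linear_scaleC)

lemma bop_apply_scaleC: "A \<cdot> (a *\<^sub>C x) = a *\<^sub>C (A \<cdot> x)"
  by transfer simp

lemma bounded_linear_bop_apply: "bounded_linear (bop_apply A)"
  by transfer (rule blinfun.bounded_linear_right)

lemmas bop_apply_linear =
  bounded_linear_bop_apply [THEN bounded_linear.linear, THEN linear_add]
  bounded_linear_bop_apply [THEN bounded_linear.linear, THEN linear_diff]
  bounded_linear_bop_apply [THEN bounded_linear.linear, THEN linear_neg]
  bounded_linear_bop_apply [THEN bounded_linear.linear, THEN linear_0]
  bounded_linear_bop_apply [THEN bounded_linear.linear, THEN linear_scale]
  bop_apply_scaleC

lemma bop_apply_sum: "(\<Sum>i\<in>I. A i) \<cdot> x = (\<Sum>i\<in>I. A i \<cdot> x)"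
  by (induction I rule: infinite_finite_induct) auto

lemma norm_bop_apply: "norm (A \<cdot> x) \<le> norm A * norm x"
  by transfer (rule norm_blinfun)

lemma norm_bop_le: "0 \<le> M \<Longrightarrow> (\<And>x. norm (A \<cdot> x) \<le> M * norm x) \<Longrightarrow> norm A \<le> M"
  by transfer (rule norm_blinfun_bound)

lemma norm_bop_apply_le: "norm A \<le> 1 \<Longrightarrow> norm (A \<cdot> x) \<le> norm x"
  using norm_bop_apply [of A x] mult_right_mono [of "norm A" 1 "norm x"] by simp

lemma norm_one_bop_le: "norm (1 :: 'a::complex_inner bop) \<le> 1"
  by (rule norm_bop_le) auto

lemma bop_exists:
  fixes f :: "'a::complex_inner \<Rightarrow> 'a"
  assumes add: "\<And>x y. f (x + y) = f x + f y" and scale: "\<And>a x. f (a *\<^sub>C x) = a *\<^sub>C f x"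
    and bound: "\<And>x. norm (f x) \<le> M * norm x"
  obtains A where "\<And>x. A \<cdot> x = f x"
proof -
  have f: "bounded_linear f"
    by (rule bounded_linear_intro [where K = M])
      (simp_all add: add scale scaleR_scaleC bound mult.commute)
  have "bop_apply (Abs_bop (Blinfun f)) = f"
    by (simp add: bop_apply.rep_eq Abs_bop_inverse bounded_linear_Blinfun_apply f scale)
  then show ?thesis using that by metis
qed

lemma bop_scaleC_mult [simp]:
  "(a *\<^sub>C A) * B = a *\<^sub>C (A * B :: 'a::complex_inner bop)" "A * (a *\<^sub>C B) = a *\<^sub>C (A * B)"
  by (rule bop_eqI; simp add: bop_apply_scaleC)+

text \<open>Complex homogeneity survives pointwise limits, so completeness is inherited from the
  bounded real-linear maps. It is what lets the iteration for square roots converge.\<close>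

instance bop :: (complex_hilbert_space) banach
proof
  fix X :: "nat \<Rightarrow> 'a bop"
  assume "Cauchy X"
  then have "Cauchy (\<lambda>n. Rep_bop (X n))"
    by (simp add: Cauchy_iff norm_bop.rep_eq minus_bop.rep_eq)
  then obtain L where L: "(\<lambda>n. Rep_bop (X n)) \<longlonglongrightarrow> L"
    using Cauchy_convergent convergentD by blast
  have lim: "(\<lambda>n. X n \<cdot> x) \<longlonglongrightarrow> L x" for x
    unfolding bop_apply.rep_eq by (intro tendsto_intros L)
  have "L (a *\<^sub>C x) = a *\<^sub>C L x" for a x
  proof (rule LIMSEQ_unique)
    show "(\<lambda>n. X n \<cdot> (a *\<^sub>C x)) \<longlonglongrightarrow> L (a *\<^sub>C x)" by (rule lim)
    show "(\<lambda>n. X n \<cdot> (a *\<^sub>C x)) \<longlonglongrightarrow> a *\<^sub>C L x"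
      unfolding bop_apply_scaleC
      by (rule bounded_linear.tendsto [OF bounded_linear_scaleC lim])
  qed
  then have "Rep_bop (Abs_bop L) = L"
    by (simp add: Abs_bop_inverse)
  then have "X \<longlonglongrightarrow> Abs_bop L"
    using L by (simp add: LIMSEQ_iff norm_bop.rep_eq minus_bop.rep_eq)
  then show "convergent X" by (rule convergentI)
qed

subsection \<open>Adjoints\<close>

lemma adj_exists: "\<exists>B. \<forall>x y. \<langle>A \<cdot> x, y\<rangle> = \<langle>x, B \<cdot> y\<rangle>" for A :: "'a::complex_hilbert_space bop"
proof -
  have "\<exists>z. \<forall>x. \<langle>A \<cdot> x, y\<rangle> = \<langle>x, z\<rangle>" for y
    by (rule Riesz_representation [of "\<lambda>x. \<langle>A \<cdot> x, y\<rangle>"])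
      (auto intro: bounded_linear_compose [OF bounded_linear_cinner_left bounded_linear_bop_apply]
        simp: cinner_simps bop_apply_scaleC)
  then obtain f where f: "\<And>x y. \<langle>A \<cdot> x, y\<rangle> = \<langle>x, f y\<rangle>" by metis
  have "f (x + y) = f x + f y" "f (a *\<^sub>C x) = a *\<^sub>C f x" for a x y
    by (rule cinner_ext_right, simp add: cinner_simps flip: f)+
  moreover have "norm (f y) \<le> norm A * norm y" for y
  proof -
    have "norm (f y) * norm (f y) = cmod \<langle>A \<cdot> f y, y\<rangle>"
      by (simp add: f cinner_self norm_power power2_eq_square norm_mult)
    also have "\<dots> \<le> norm A * norm (f y) * norm y"
      by (rule order_trans [OF cinner_Cauchy_Schwarz mult_right_mono [OF norm_bop_apply]]) simp
    finally have "norm (f y) * norm (f y) \<le> norm (f y) * (norm A * norm y)" by (simp add: ac_simps)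
    then show ?thesis
      by (cases "norm (f y) = 0") (auto simp: mult_le_cancel_left)
  qed
  ultimately obtain B where "\<And>x. B \<cdot> x = f x" using bop_exists by metis
  then show ?thesis using f by metis
qed

lemma cinner_adj_right: "\<langle>x, A\<^sup>* \<cdot> y\<rangle> = \<langle>A \<cdot> x, y\<rangle>"
proof -
  obtain B where B: "\<forall>x y. \<langle>A \<cdot> x, y\<rangle> = \<langle>x, B \<cdot> y\<rangle>"
    using adj_exists by blast
  have "A\<^sup>* = B"
    unfolding adj_def
  proof (rule the_equality)
    show "\<forall>x y. \<langle>A \<cdot> x, y\<rangle> = \<langle>x, B \<cdot> y\<rangle>" by (rule B)
    fix C assume "\<forall>x y. \<langle>A \<cdot> x, y\<rangle> = \<langle>x, C \<cdot> y\<rangle>"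
    then show "C = B" using B by (metis bop_eqI cinner_ext_right)
  qed
  then show ?thesis using B by simp
qed

lemma cinner_adj_left: "\<langle>A\<^sup>* \<cdot> x, y\<rangle> = \<langle>x, A \<cdot> y\<rangle>"
  by (metis cinner_adj_right cinner_commute)

lemma adj_eqI: "(\<And>x y. \<langle>A \<cdot> x, y\<rangle> = \<langle>x, B \<cdot> y\<rangle>) \<Longrightarrow> A\<^sup>* = B"
  by (metis bop_eqI cinner_ext_right cinner_adj_right)

lemma adj_adj [simp]: "(A\<^sup>*)\<^sup>* = A"
  by (rule adj_eqI) (rule cinner_adj_left)

lemma adj_simps [simp]:
  "(A + B)\<^sup>* = A\<^sup>* + B\<^sup>*" "(A - B)\<^sup>* = A\<^sup>* - B\<^sup>*" "(- A)\<^sup>* = - (A\<^sup>*)" "(r *\<^sub>R A)\<^sup>* = r *\<^sub>R (A\<^sup>*)"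
  "(a *\<^sub>C A)\<^sup>* = cnj a *\<^sub>C (A\<^sup>*)" "(A * B)\<^sup>* = B\<^sup>* * A\<^sup>*"
  "1\<^sup>* = (1 :: 'a::complex_hilbert_space bop)" "0\<^sup>* = (0 :: 'a bop)"
  by (rule adj_eqI; simp add: cinner_simps cinner_adj_right)+

lemma norm_adj [simp]: "norm (A\<^sup>*) = norm A"
proof -
  have le: "norm (A\<^sup>*) \<le> norm A" for A :: "'a bop"
  proof (rule norm_bop_le)
    fix y
    have "norm (A\<^sup>* \<cdot> y) * norm (A\<^sup>* \<cdot> y) = cmod \<langle>A \<cdot> (A\<^sup>* \<cdot> y), y\<rangle>"
      by (simp add: cinner_self norm_power power2_eq_square norm_mult flip: cinner_adj_right)
    also have "\<dots> \<le> norm A * norm (A\<^sup>* \<cdot> y) * norm y"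
      by (rule order_trans [OF cinner_Cauchy_Schwarz mult_right_mono [OF norm_bop_apply]]) simp
    finally have "norm (A\<^sup>* \<cdot> y) * norm (A\<^sup>* \<cdot> y) \<le> norm (A\<^sup>* \<cdot> y) * (norm A * norm y)"
      by (simp add: ac_simps)
    then show "norm (A\<^sup>* \<cdot> y) \<le> norm A * norm y"
      by (cases "norm (A\<^sup>* \<cdot> y) = 0") (auto simp: mult_le_cancel_left)
  qed simp
  show ?thesis using le [of A] le [of "A\<^sup>*"] by simp
qed

lemma bounded_linear_adj: "bounded_linear adj"
  by (rule bounded_linear_intro [where K = 1]) auto

lemma norm_bop_apply_square: "complex_of_real ((norm (A \<cdot> x))\<^sup>2) = \<langle>(A\<^sup>* * A) \<cdot> x, x\<rangle>"
  by (simp add: cinner_adj_left cinner_self)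

lemma isometry_iff: "A\<^sup>* * A = 1 \<longleftrightarrow> (\<forall>x. norm (A \<cdot> x) = norm x)"
proof
  assume A: "A\<^sup>* * A = 1"
  show "\<forall>x. norm (A \<cdot> x) = norm x"
  proof
    fix x
    have "complex_of_real ((norm (A \<cdot> x))\<^sup>2) = complex_of_real ((norm x)\<^sup>2)"
      unfolding norm_bop_apply_square A by (simp only: bop_apply_simps cinner_self)
    then have "(norm (A \<cdot> x))\<^sup>2 = (norm x)\<^sup>2" using of_real_eq_iff by blast
    then show "norm (A \<cdot> x) = norm x" by (simp add: power2_eq_iff_nonneg)
  qed
next
  assume A: "\<forall>x. norm (A \<cdot> x) = norm x"
  define T where "T = A\<^sup>* * A - 1"
  have q: "\<langle>T \<cdot> x, x\<rangle> = 0" for x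
    using norm_bop_apply_square [of A x] A by (simp add: T_def cinner_simps cinner_self)
  \<comment> \<open>Polarization: the quadratic form of \<open>T\<close> vanishes at
    \<open>x + y\<close> and at \<open>x + \<i> *\<^sub>C y\<close>.\<close>
  have "\<langle>T \<cdot> x, y\<rangle> = 0" for x y
  proof -
    have "\<langle>T \<cdot> x, y\<rangle> + \<langle>T \<cdot> y, x\<rangle> = 0"
      using q [of "x + y"] by (simp add: bop_apply_linear cinner_simps q add.commute)
    moreover have "\<i> * \<langle>T \<cdot> y, x\<rangle> - \<i> * \<langle>T \<cdot> x, y\<rangle> = 0"
      using q [of "x + \<i> *\<^sub>C y"] by (simp add: bop_apply_linear cinner_simps q)
    ultimately show ?thesis by (simp add: complex_eq_iff)
  qed
  then have "T = 0" by (intro bop_eqI cinner_ext) simp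
  then show "A\<^sup>* * A = 1" by (simp add: T_def)
qed

lemma norm_isometry: "A\<^sup>* * A = 1 \<Longrightarrow> norm A \<le> 1"
  by (rule norm_bop_le) (auto simp: isometry_iff)

text \<open>Uniqueness of the orthogonal decomposition makes the component in \<open>K\<close>
  depend linearly on the vector.\<close>

lemma closed_subspace_projection:
  fixes K :: "'a::complex_hilbert_space set"
  assumes K: "complex_vector.subspace K" "closed K"
  obtains Q where "Q\<^sup>* = Q" "Q * Q = Q" "\<And>x. Q \<cdot> x \<in> K" "\<And>x. x \<in> K \<Longrightarrow> Q \<cdot> x = x"
proof -
  have "\<exists>k\<in>K. \<forall>y\<in>K. \<langle>x - k, y\<rangle> = 0" for x
    by (rule orthogonal_decomposition [OF K, of x]) blast
  then obtain q where q: "\<And>x. q x \<in> K" "\<And>x y. y \<in> K \<Longrightarrow> \<langle>x - q x, y\<rangle> = 0" by metis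
  have uniq: "q x = k" if "k \<in> K" "\<And>y. y \<in> K \<Longrightarrow> \<langle>x - k, y\<rangle> = 0" for x k
  proof -
    have d: "q x - k \<in> K" using K(1) q(1) that(1) by (rule complex_vector.subspace_diff)
    have "\<langle>q x - k, q x - k\<rangle> = \<langle>x - k, q x - k\<rangle> - \<langle>x - q x, q x - k\<rangle>"
      by (simp add: cinner_simps)
    also have "\<dots> = 0" using that(2) [OF d] q(2) [OF d] by simp
    finally show ?thesis by simp
  qed
  have ort: "\<langle>q x, k\<rangle> = \<langle>x, k\<rangle>" if "k \<in> K" for x k
    using q(2) [OF that, of x] by (simp add: cinner_simps)
  have "q (x + y) = q x + q y" "q (a *\<^sub>C x) = a *\<^sub>C q x" for a x y
    by (rule uniq; simp add: q K complex_vector.subspace_add complex_vector.subspace_scale cinner_simps ort)+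
  moreover have "norm (q x) \<le> 1 * norm x" for x
  proof -
    have "\<langle>x, q x\<rangle> = \<langle>q x, q x\<rangle>" by (rule ort [OF q(1), symmetric])
    then have "norm (q x) * norm (q x) = cmod \<langle>x, q x\<rangle>"
      by (simp add: cinner_self norm_power power2_eq_square norm_mult)
    also have "\<dots> \<le> norm (q x) * norm x" using cinner_Cauchy_Schwarz [of x "q x"] by (simp add: mult.commute)
    finally show ?thesis by (cases "norm (q x) = 0") (auto simp: mult_le_cancel_left)
  qed
  ultimately obtain Q where Q: "\<And>x. Q \<cdot> x = q x" using bop_exists by metis
  have qK: "q x = x" if "x \<in> K" for x by (rule uniq) (simp_all add: that)
  show ?thesis
  proof
    show "Q\<^sup>* = Q"
    proof (rule adj_eqI)
      fix x y
      have "\<langle>q x, y\<rangle> = cnj \<langle>y, q x\<rangle>" by (rule cinner_commute)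
      also have "\<dots> = cnj \<langle>q y, q x\<rangle>" by (simp only: ort [OF q(1)])
      also have "\<dots> = \<langle>q x, q y\<rangle>" by (rule cinner_commute [symmetric])
      also have "\<dots> = \<langle>x, q y\<rangle>" by (rule ort [OF q(1)])
      finally show "\<langle>Q \<cdot> x, y\<rangle> = \<langle>x, Q \<cdot> y\<rangle>" by (simp add: Q)
    qed
  qed (auto simp: Q q qK intro: bop_eqI)
qed

subsection \<open>Rank-one operators\<close>

lemma bounded_linear_cinner_scaleC: "bounded_linear (\<lambda>z. \<langle>z, y\<rangle> *\<^sub>C x)"
  for x y :: "'a::complex_inner"
  by (rule bounded_linear_intro [where K = "norm y * norm x"])
    (use mult_right_mono [OF cinner_Cauchy_Schwarz [of _ y], of "norm x"] in
      \<open>simp_all add: cinner_simps scaleC_add_left scaleR_scaleC scaleC_scaleC norm_scaleC mult.assoc\<close>)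

lift_definition rank_one :: "'a::complex_inner \<Rightarrow> 'a \<Rightarrow> 'a bop" is
  "\<lambda>x y. Blinfun (\<lambda>z. \<langle>z, y\<rangle> *\<^sub>C x)"
  by (simp add: bounded_linear_Blinfun_apply bounded_linear_cinner_scaleC cinner_simps scaleC_scaleC)

lemma rank_one_apply [simp]: "rank_one x y \<cdot> z = \<langle>z, y\<rangle> *\<^sub>C x"
  by transfer (simp add: bounded_linear_Blinfun_apply bounded_linear_cinner_scaleC)

lemma rank_one_simps:
  "rank_one (x + x') y = rank_one x y + rank_one x' y"
  "rank_one (a *\<^sub>C x) y = a *\<^sub>C rank_one x y"
  "A * rank_one x y = rank_one (A \<cdot> x) y"
  "rank_one x y * rank_one x' y' = \<langle>x', y\<rangle> *\<^sub>C rank_one x y'"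
  by (auto intro!: bop_eqI simp: scaleC_add_right scaleC_scaleC mult.commute bop_apply_linear cinner_simps)

lemma adj_rank_one [simp]: "(rank_one x y)\<^sup>* = rank_one y x"
  by (rule adj_eqI) (simp add: cinner_simps cinner_commute [of x] mult.commute)

subsection \<open>Extreme points of the unit ball\<close>

text \<open>Symmetric perturbations replace segments: a point inside a segment is the midpoint of a
  smaller segment in the same direction.\<close>

lemma extreme_point_of_unit_ball_iff:
  fixes A :: "'a::real_normed_vector"
  shows "A extreme_point_of {B. norm B \<le> 1} \<longleftrightarrow>
    norm A \<le> 1 \<and> (\<forall>C. norm (A + C) \<le> 1 \<longrightarrow> norm (A - C) \<le> 1 \<longrightarrow> C = 0)"
proof (intro iffI conjI allI impI)
  assume A: "A extreme_point_of {B. norm B \<le> 1}"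
  then show "norm A \<le> 1" by (simp add: extreme_point_of_def)
  fix C assume C: "norm (A + C) \<le> 1" "norm (A - C) \<le> 1"
  have "midpoint (A + C) (A - C) = A"
    by (simp add: midpoint_def flip: scaleR_2)
  then have "A + C = A - C"
    using A C midpoint_in_open_segment [of "A + C" "A - C"] by (auto simp: extreme_point_of_def)
  then have "2 *\<^sub>R C = 0" by (simp add: scaleR_2 eq_diff_eq add.assoc)
  then show "C = 0" by simp
next
  assume A: "norm A \<le> 1 \<and> (\<forall>C. norm (A + C) \<le> 1 \<longrightarrow> norm (A - C) \<le> 1 \<longrightarrow> C = 0)"
  have "A \<notin> open_segment a b" if ab: "norm a \<le> 1" "norm b \<le> 1" for a b
  proof
    assume "A \<in> open_segment a b"
    then obtain u where u: "a \<noteq> b" "0 < u" "u < 1" and Au: "A = (1 - u) *\<^sub>R a + u *\<^sub>R b"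
      by (auto simp: in_segment)
    define m where "m = min u (1 - u)"
    have conv: "norm ((1 - t) *\<^sub>R a + t *\<^sub>R b) \<le> 1" if "0 \<le> t" "t \<le> 1" for t
    proof -
      have "norm ((1 - t) *\<^sub>R a + t *\<^sub>R b) \<le> (1 - t) * norm a + t * norm b"
        using that by (intro norm_triangle_le) simp
      also have "\<dots> \<le> (1 - t) * 1 + t * 1"
        using that ab by (intro add_mono mult_left_mono) auto
      finally show ?thesis by simp
    qed
    have "A + m *\<^sub>R (b - a) = (1 - (u + m)) *\<^sub>R a + (u + m) *\<^sub>R b"
      "A - m *\<^sub>R (b - a) = (1 - (u - m)) *\<^sub>R a + (u - m) *\<^sub>R b"
      by (simp_all add: Au algebra_simps)
    then have "norm (A + m *\<^sub>R (b - a)) \<le> 1" "norm (A - m *\<^sub>R (b - a)) \<le> 1"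
      using conv [of "u + m"] conv [of "u - m"] u by (auto simp: m_def min_def)
    then have "m *\<^sub>R (b - a) = 0" using A by blast
    then show False using u by (simp add: m_def min_def split: if_splits)
  qed
  with A show "A extreme_point_of {B. norm B \<le> 1}" by (auto simp: extreme_point_of_def)
qed

lemma norm_mult_le_one: "norm a \<le> 1 \<Longrightarrow> norm b \<le> 1 \<Longrightarrow> norm (a * b) \<le> 1"
  for a b :: "'a::real_normed_algebra"
  using norm_mult_ineq [of a b] mult_mono [of "norm a" 1 "norm b" 1] by simp

text \<open>By the parallelogram law the squared norms of \<open>A \<cdot> x\<close> and
  \<open>C \<cdot> x\<close> add up to at most that of \<open>x\<close>, which the first one already
  exhausts.\<close>

lemma isometry_midpoint:
  assumes A: "A\<^sup>* * A = 1" and "norm (A + C) \<le> 1" "norm (A - C) \<le> 1"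
  shows "C = 0"
proof -
  have "C \<cdot> x = 0" for x
  proof -
    have "(norm (A \<cdot> x + C \<cdot> x))\<^sup>2 \<le> (norm x)\<^sup>2" "(norm (A \<cdot> x - C \<cdot> x))\<^sup>2 \<le> (norm x)\<^sup>2"
      using assms norm_bop_apply_le [of "A + C" x] norm_bop_apply_le [of "A - C" x]
      by (auto intro: power_mono)
    moreover have "(norm (A \<cdot> x))\<^sup>2 = (norm x)\<^sup>2" using A by (simp add: isometry_iff)
    ultimately have "(norm (C \<cdot> x))\<^sup>2 \<le> 0"
      using parallelogram_law [of "A \<cdot> x" "C \<cdot> x"] by linarith
    then show ?thesis by simp
  qed
  then show ?thesis by (intro bop_eqI) simp
qed

text \<open>\<open>A\<close> is perturbed by half of \<open>A * S\<close>. On a singular value t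
  this gives t (1 + (1 - t^2) / 2) and t (1 - (1 - t^2) / 2), both still in [0, 1], so extremality
  forces \<open>A * S = 0\<close>.\<close>

lemma extreme_imp_partial_isometry:
  assumes nA: "norm A \<le> 1"
    and ext: "\<And>C. norm (A + C) \<le> 1 \<Longrightarrow> norm (A - C) \<le> 1 \<Longrightarrow> C = 0"
  shows "A * A\<^sup>* * A = A"
proof -
  define S where "S = 1 - A\<^sup>* * A"
  define C where "C = (1/2) *\<^sub>R (A * S)"
  have Sa: "S\<^sup>* = S" by (simp add: S_def)
  have Spos: "0 \<le> Re \<langle>S \<cdot> x, x\<rangle>" for x
  proof -
    have "\<langle>S \<cdot> x, x\<rangle> = complex_of_real ((norm x)\<^sup>2 - (norm (A \<cdot> x))\<^sup>2)"
      using norm_bop_apply_square [of A x] by (simp add: S_def cinner_simps cinner_self)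
    then show ?thesis
      using norm_bop_apply_le [OF nA, of x] by (simp add: power_mono)
  qed
  have nT: "norm (A\<^sup>* * A) \<le> 1"
    using nA by (simp add: norm_mult_le_one)
  have "norm (A + C) \<le> 1"
  proof (rule norm_bop_le)
    fix x
    have AS: "A\<^sup>* * A = 1 - S" by (simp add: S_def)
    \<comment> \<open>The terms linear in \<open>S\<close> cancel; those that remain are subtracted
      and nonnegative, as \<open>S\<close> is positive.\<close>
    have "(A + C)\<^sup>* * (A + C) = (1 + (1/2) *\<^sub>R S) * (A\<^sup>* * A) * (1 + (1/2) *\<^sub>R S)"
      by (simp add: C_def Sa algebra_simps)
    also have "\<dots> = 1 - (3/4) *\<^sub>R (S * S) - (1/4) *\<^sub>R (S * S * S)"
      unfolding AS by (simp add: algebra_simps flip: scaleR_add_left)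
    finally have "complex_of_real ((norm ((A + C) \<cdot> x))\<^sup>2) =
        \<langle>(1 - (3/4) *\<^sub>R (S * S) - (1/4) *\<^sub>R (S * S * S)) \<cdot> x, x\<rangle>"
      by (simp only: norm_bop_apply_square)
    also have "\<dots> = complex_of_real ((norm x)\<^sup>2) - (3/4) * complex_of_real ((norm (S \<cdot> x))\<^sup>2)
        - (1/4) * \<langle>S \<cdot> (S \<cdot> x), S \<cdot> x\<rangle>"
      unfolding norm_bop_apply_square using cinner_adj_left [of S]
      by (simp add: cinner_simps Sa cinner_self)
    finally have "(norm ((A + C) \<cdot> x))\<^sup>2
        = (norm x)\<^sup>2 - (3/4) * (norm (S \<cdot> x))\<^sup>2 - (1/4) * Re \<langle>S \<cdot> (S \<cdot> x), S \<cdot> x\<rangle>"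
      by (simp add: complex_eq_iff)
    then have "(norm ((A + C) \<cdot> x))\<^sup>2 \<le> (norm x)\<^sup>2"
      using Spos [of "S \<cdot> x"] zero_le_power2 [of "norm (S \<cdot> x)"] by linarith
    then show "norm ((A + C) \<cdot> x) \<le> 1 * norm x" unfolding mult_1 by (rule power2_le_imp_le) simp
  qed simp
  moreover have "norm (A - C) \<le> 1"
  proof -
    have "A - C = A * ((1/2) *\<^sub>R (1 + A\<^sup>* * A))"
      by (simp add: C_def S_def algebra_simps flip: scaleR_add_left)
    moreover have "norm ((1/2) *\<^sub>R (1 + A\<^sup>* * A)) \<le> 1"
      using norm_triangle_le [OF order_trans [OF add_mono [OF norm_one_bop_le nT]], of 2] by simp
    ultimately show ?thesis using norm_mult_le_one [OF nA] by metis
  qed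
  ultimately have "C = 0" by (rule ext)
  then show ?thesis by (simp add: C_def S_def algebra_simps)
qed

text \<open>If neither \<open>A\<^sup>* * A\<close> nor \<open>A * A\<^sup>*\<close> is \<open>1\<close>, then the partial isometry \<open>A\<close> is the midpoint of
  \<open>A + C\<close> and \<open>A - C\<close>, where \<open>C\<close> has rank one and maps the kernel of \<open>A\<close> to the orthogonal
  complement of its range.\<close>

lemma extreme_point_bop_iff:
  "A extreme_point_of {B. norm B \<le> 1} \<longleftrightarrow> A\<^sup>* * A = 1 \<or> A * A\<^sup>* = 1"
proof
  assume "A\<^sup>* * A = 1 \<or> A * A\<^sup>* = 1"
  then show "A extreme_point_of {B. norm B \<le> 1}"
  proof
    assume A: "A\<^sup>* * A = 1"
    then show ?thesis
      using norm_isometry [OF A] isometry_midpoint [OF A]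
      by (simp add: extreme_point_of_unit_ball_iff)
  next
    assume A: "A * A\<^sup>* = 1"
    have "C = 0" if "norm (A + C) \<le> 1" "norm (A - C) \<le> 1" for C
    proof -
      have "norm (A\<^sup>* + C\<^sup>*) \<le> 1" "norm (A\<^sup>* - C\<^sup>*) \<le> 1"
        using that by (simp_all flip: adj_simps)
      then have "C\<^sup>* = 0" using isometry_midpoint [of "A\<^sup>*" "C\<^sup>*"] A by simp
      then show ?thesis by (metis adj_adj adj_simps(8))
    qed
    then show ?thesis
      using norm_isometry [of "A\<^sup>*"] A by (simp add: extreme_point_of_unit_ball_iff)
  qed
next
  assume "A extreme_point_of {B. norm B \<le> 1}"
  then have nA: "norm A \<le> 1"
    and ext: "\<And>C. norm (A + C) \<le> 1 \<Longrightarrow> norm (A - C) \<le> 1 \<Longrightarrow> C = 0"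
    by (auto simp: extreme_point_of_unit_ball_iff)
  have pA: "A * A\<^sup>* * A = A" by (rule extreme_imp_partial_isometry [OF nA ext])
  then have pA': "A\<^sup>* * A * A\<^sup>* = A\<^sup>*"
    by (metis adj_adj adj_simps(6) mult.assoc)
  show "A\<^sup>* * A = 1 \<or> A * A\<^sup>* = 1"
  proof (rule ccontr)
    assume "\<not> ?thesis"
    then obtain x0 y0 where "(A\<^sup>* * A) \<cdot> x0 \<noteq> 1 \<cdot> x0" "(A * A\<^sup>*) \<cdot> y0 \<noteq> 1 \<cdot> y0"
      by (metis bop_eqI)
    define x where "x = (1 - A\<^sup>* * A) \<cdot> x0"
    define y where "y = (1 - A * A\<^sup>*) \<cdot> y0"
    have x0: "x \<noteq> 0" and y0: "y \<noteq> 0"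
      using \<open>(A\<^sup>* * A) \<cdot> x0 \<noteq> 1 \<cdot> x0\<close> \<open>(A * A\<^sup>*) \<cdot> y0 \<noteq> 1 \<cdot> y0\<close> by (auto simp: x_def y_def)
    have "A * (1 - A\<^sup>* * A) = 0" "A\<^sup>* * (1 - A * A\<^sup>*) = 0"
      using pA pA' by (simp_all add: algebra_simps)
    then have Ax: "A \<cdot> x = 0" and Ay: "A\<^sup>* \<cdot> y = 0"
      unfolding x_def y_def by (metis bop_apply_simps(1,7))+
    define C where "C = (1 / (norm x * norm y)) *\<^sub>R rank_one y x"
    have C: "(norm (A \<cdot> z + C \<cdot> z))\<^sup>2 \<le> (norm z)\<^sup>2" "(norm (A \<cdot> z - C \<cdot> z))\<^sup>2 \<le> (norm z)\<^sup>2" for z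
    proof -
      \<comment> \<open>\<open>C \<cdot> z\<close> is orthogonal to the range of \<open>A\<close>,
        and its squared norm is exactly what \<open>A\<close> loses by annihilating the component of
        \<open>z\<close> along \<open>x\<close>.\<close>
      have "\<langle>A \<cdot> z, C \<cdot> z\<rangle> = 0"
        using cinner_adj_right [of z A y] by (simp add: C_def cinner_simps Ay)
      moreover have "(norm (C \<cdot> z))\<^sup>2 = (cmod \<langle>z, x\<rangle>)\<^sup>2 / (norm x)\<^sup>2"
        using y0 by (simp add: C_def norm_scaleC power_divide power_mult_distrib)
      moreover have "(norm (A \<cdot> z))\<^sup>2 \<le> (norm z)\<^sup>2 - (cmod \<langle>z, x\<rangle>)\<^sup>2 / (norm x)\<^sup>2"
      proof -
        have "A \<cdot> z = A \<cdot> (z - (\<langle>z, x\<rangle> / of_real ((norm x)\<^sup>2)) *\<^sub>C x)"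
          by (simp add: bop_apply_linear Ax)
        then show ?thesis
          unfolding norm_diff_component [OF x0, symmetric]
          using power_mono [OF norm_bop_apply_le [OF nA]] by (metis norm_ge_zero)
      qed
      ultimately show "(norm (A \<cdot> z + C \<cdot> z))\<^sup>2 \<le> (norm z)\<^sup>2" "(norm (A \<cdot> z - C \<cdot> z))\<^sup>2 \<le> (norm z)\<^sup>2"
        by (simp_all add: norm_add_square norm_diff_square)
    qed
    have "norm (A + C) \<le> 1" "norm (A - C) \<le> 1"
      by (intro norm_bop_le; simp; intro power2_le_imp_le [OF C(1)] power2_le_imp_le [OF C(2)]; simp)+
    then have "C = 0" by (rule ext)
    then have "C \<cdot> x = 0" by simp
    then show False using x0 y0 by (simp add: C_def cinner_self)
  qed
qed

subsection \<open>Square roots and unitary operators\<close>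

text \<open>The iterates \<open>Y (n+1) = (T + Y n * Y n) / 2\<close> are dominated by the scalar iterates for \<open>T = 1\<close>,
  which increase and are bounded by \<open>1\<close>.\<close>

lemma square_root_exists:
  fixes T :: "'a::complex_hilbert_space bop"
  assumes T: "T\<^sup>* = T" and nT: "norm T \<le> 1"
  obtains Y where "Y\<^sup>* = Y" "norm Y \<le> 1" "(1 - Y) * (1 - Y) = 1 - T"
    "\<And>C. C * T = T * C \<Longrightarrow> C * Y = Y * C"
proof -
  define Y where "Y n = ((\<lambda>Z. (1/2) *\<^sub>R (T + Z * Z)) ^^ n) 0" for n
  define y where "y n = ((\<lambda>z. (1 + z * z) / 2) ^^ n) (0::real)" for n
  have Y: "Y 0 = 0" "Y (Suc n) = (1/2) *\<^sub>R (T + Y n * Y n)" for n by (simp_all add: Y_def)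
  have y: "y 0 = 0" "y (Suc n) = (1 + y n * y n) / 2" for n by (simp_all add: y_def)
  have y01: "0 \<le> y n \<and> y n \<le> 1" for n
  proof (induction n)
    case (Suc n)
    then have "y n * y n \<le> 1 * 1" by (intro mult_mono) auto
    then show ?case by (simp add: y)
  qed (simp add: y)
  have nY: "norm (Y n) \<le> y n" for n
  proof (induction n)
    case (Suc n)
    have "norm (T + Y n * Y n) \<le> 1 + y n * y n"
      using nT Suc y01 [of n] norm_mult_ineq [of "Y n" "Y n"] mult_mono [OF Suc Suc]
      by (intro norm_triangle_le) auto
    then show ?case by (simp add: Y y)
  qed (simp add: Y y)
  have dY: "norm (Y (Suc n) - Y n) \<le> y (Suc n) - y n" for n
  proof (induction n)
    case 0
    then show ?case using nT by (simp add: Y y)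
  next
    case (Suc n)
    \<comment> \<open>The difference of two squares is factored without commutativity; the scalars
      obey the same identity, so domination passes to the next step.\<close>
    have "Y (Suc (Suc n)) - Y (Suc n)
        = (1/2) *\<^sub>R (Y (Suc n) * (Y (Suc n) - Y n) + (Y (Suc n) - Y n) * Y n)"
      unfolding Y(2) [of "Suc n"] Y(2) [of n, THEN arg_cong [where f = "\<lambda>Z. A - Z" for A]]
      by (simp add: algebra_simps)
    also have "norm \<dots> \<le> (1/2) * (y (Suc n) * (y (Suc n) - y n) + (y (Suc n) - y n) * y n)"
      unfolding norm_scaleR using Suc nY y01 order_trans [OF norm_ge_zero Suc]
      by (intro mult_mono norm_triangle_le add_mono order_trans [OF norm_mult_ineq]) auto
    also have "\<dots> = y (Suc (Suc n)) - y (Suc n)"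
      unfolding y(2) [of "Suc n"] y(2) [of n, THEN arg_cong [where f = "\<lambda>z. a - z" for a]]
      by (simp add: algebra_simps)
    finally show ?case .
  qed
  have "summable (\<lambda>n. y (Suc n) - y n)"
  proof (rule summableI_nonneg_bounded)
    show "0 \<le> y (Suc n) - y n" for n using dY [of n] norm_ge_zero order_trans by blast
    show "(\<Sum>i<n. y (Suc i) - y i) \<le> 1" for n
      using y01 [of n] y01 [of 0] unfolding sum_lessThan_telescope by linarith
  qed
  then have "summable (\<lambda>n. Y (Suc n) - Y n)"
    by (rule summable_comparison_test' [where N = 0]) (rule dY)
  then have "(\<lambda>n. \<Sum>i<n. Y (Suc i) - Y i) \<longlonglongrightarrow> (\<Sum>n. Y (Suc n) - Y n)"
    by (rule summable_LIMSEQ)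
  then obtain L where L: "Y \<longlonglongrightarrow> L"
    unfolding sum_lessThan_telescope Y(1) by simp
  have inv: "C * Y n = Y n * C" if "C * T = T * C" for C n
  proof (induction n)
    case (Suc n)
    have "C * (Y n * Y n) = (Y n * Y n) * C" using Suc by (metis mult.assoc)
    then show ?case using that by (simp add: Y algebra_simps)
  qed (simp add: Y)
  have sa: "(Y n)\<^sup>* = Y n" for n
    by (induction n) (auto simp: Y T)
  show ?thesis
  proof
    show "L\<^sup>* = L"
      using bounded_linear.tendsto [OF bounded_linear_adj L] L by (simp add: sa LIMSEQ_unique)
    show "norm L \<le> 1"
      using nY y01 order_trans by (intro LIMSEQ_le_const2 [OF tendsto_norm [OF L]]) blast
    have "(\<lambda>n. (1/2) *\<^sub>R (T + Y n * Y n)) \<longlonglongrightarrow> (1/2) *\<^sub>R (T + L * L)"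
      by (intro tendsto_intros L)
    moreover have "(\<lambda>n. (1/2) *\<^sub>R (T + Y n * Y n)) \<longlonglongrightarrow> L"
      using LIMSEQ_Suc [OF L] by (simp add: Y)
    ultimately have "2 *\<^sub>R ((1/2) *\<^sub>R (T + L * L)) = 2 *\<^sub>R L"
      using LIMSEQ_unique by metis
    then have "T + L * L = L + L" by (simp add: scaleR_2)
    then show "(1 - L) * (1 - L) = 1 - T" by (simp add: algebra_simps eq_diff_eq)
    show "C * L = L * C" if "C * T = T * C" for C
    proof (rule LIMSEQ_unique)
      show "(\<lambda>n. C * Y n) \<longlonglongrightarrow> C * L" by (intro tendsto_intros L)
      show "(\<lambda>n. C * Y n) \<longlonglongrightarrow> L * C" unfolding inv [OF that] by (intro tendsto_intros L)
    qed
  qed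
qed

text \<open>A number in [-1, 1] is the real part of a point on the unit circle; likewise
  \<open>U\<close> is \<open>D + \<i> *\<^sub>C R\<close> with \<open>R\<close> a square root of
  \<open>1 - D * D\<close> commuting with \<open>D\<close>.\<close>

lemma self_adjoint_contraction_eq_mean:
  fixes D :: "'a::complex_hilbert_space bop"
  assumes D: "D\<^sup>* = D" and nD: "norm D \<le> 1"
  obtains U where "U\<^sup>* * U = 1" "U * U\<^sup>* = 1" "D = (1/2) *\<^sub>R (U + U\<^sup>*)"
proof -
  have "norm (D * D) \<le> 1"
    using nD by (simp add: norm_mult_le_one)
  moreover have "(D * D)\<^sup>* = D * D" by (simp add: D)
  ultimately obtain Y where Y: "Y\<^sup>* = Y" "(1 - Y) * (1 - Y) = 1 - D * D"
    and com: "\<And>C. C * (D * D) = (D * D) * C \<Longrightarrow> C * Y = Y * C"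
    using square_root_exists by metis
  define R where "R = 1 - Y"
  have R: "R\<^sup>* = R" "R * R = 1 - D * D" using Y by (simp_all add: R_def)
  have DR: "D * R = R * D" using com [of D] by (simp add: R_def algebra_simps)
  define U where "U = D + \<i> *\<^sub>C R"
  have Ua: "U\<^sup>* = D - \<i> *\<^sub>C R"
    by (simp add: U_def D R)
  have [simp]: "\<i> *\<^sub>C \<i> *\<^sub>C Z = - Z" for Z :: "'a bop"
    by (simp add: scaleC_scaleC scaleC_one)
  show ?thesis
  proof
    show "U\<^sup>* * U = 1" "U * U\<^sup>* = 1"
      unfolding Ua by (simp_all add: U_def algebra_simps R(2) DR)
    show "D = (1/2) *\<^sub>R (U + U\<^sup>*)"
      unfolding Ua by (simp add: U_def flip: scaleR_2)
  qed
qed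

text \<open>The unitary operators span: the real and imaginary parts of \<open>A\<close>, scaled to
  contractions, are means of unitaries. As an induction rule this reduces linear or conjugate-linear
  identities to unitary arguments.\<close>

lemma bop_induct_unitary [case_names unitary add scaleC]:
  fixes A :: "'a::complex_hilbert_space bop"
  assumes unitary: "\<And>U. U\<^sup>* * U = 1 \<Longrightarrow> U * U\<^sup>* = 1 \<Longrightarrow> P U"
    and add: "\<And>A B. P A \<Longrightarrow> P B \<Longrightarrow> P (A + B)"
    and scaleC: "\<And>c A. P A \<Longrightarrow> P (c *\<^sub>C A)"
  shows "P A"
proof -
  have scaleR: "P A \<Longrightarrow> P (r *\<^sub>R A)" for r A by (simp add: scaleR_scaleC scaleC)
  have sa: "P D" if D: "D\<^sup>* = D" for D
  proof -
    \<comment> \<open>The added 1 keeps \<open>c\<close> positive when \<open>D = 0\<close>.\<close>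
    define c where "c = norm D + 1"
    have c: "0 < c" by (simp add: c_def add_nonneg_pos)
    have "norm ((1 / c) *\<^sub>R D) \<le> 1" using c by (simp add: c_def)
    moreover have "((1 / c) *\<^sub>R D)\<^sup>* = (1 / c) *\<^sub>R D" by (simp add: D)
    ultimately obtain U where U: "U\<^sup>* * U = 1" "U * U\<^sup>* = 1" "(1 / c) *\<^sub>R D = (1/2) *\<^sub>R (U + U\<^sup>*)"
      using self_adjoint_contraction_eq_mean by metis
    then have "P ((1 / c) *\<^sub>R D)"
      by (simp only: U(3)) (intro scaleR add unitary; simp add: U)
    then have "P (c *\<^sub>R (1 / c) *\<^sub>R D)" by (rule scaleR)
    then show ?thesis using c by simp
  qed
  define D where "D = (1/2) *\<^sub>R (A + A\<^sup>*)"
  define E where "E = (1/2) *\<^sub>R (\<i> *\<^sub>C (A\<^sup>* - A))"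
  have "P D" by (rule sa) (simp add: D_def add.commute)
  moreover have "P E"
    by (rule sa) (simp add: E_def complex_vector.scale_right_diff_distrib)
  moreover have "A = D + \<i> *\<^sub>C E"
    by (simp add: D_def E_def scaleR_scaleC scaleC_scaleC algebra_simps
        flip: complex_vector.scale_left_distrib)
  ultimately show ?thesis using add scaleC by metis
qed

subsection \<open>Orthonormal bases and partial isometries\<close>

definition orthonormal :: "'a::complex_inner set \<Rightarrow> bool" where
  "orthonormal B \<longleftrightarrow> (\<forall>x\<in>B. \<forall>y\<in>B. \<langle>x, y\<rangle> = (if x = y then 1 else 0))"

lemma orthonormalD: "orthonormal B \<Longrightarrow> x \<in> B \<Longrightarrow> y \<in> B \<Longrightarrow> \<langle>x, y\<rangle> = (if x = y then 1 else 0)"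
  by (simp add: orthonormal_def)

lemma orthonormal_subset: "orthonormal B \<Longrightarrow> C \<subseteq> B \<Longrightarrow> orthonormal C"
  unfolding orthonormal_def by blast

lemma cinner_normalize:
  assumes "x \<noteq> 0"
  shows "\<langle>inverse (norm x) *\<^sub>R x, inverse (norm x) *\<^sub>R x\<rangle> = 1"
  using assms by (simp add: cinner_simps cinner_self power2_eq_square field_simps)

text \<open>Zorn's lemma gives a maximal orthonormal set in the range of \<open>Q\<close>. If
  \<open>x\<close> is orthogonal to it and \<open>Q \<cdot> x\<close> is nonzero, normalizing
  \<open>Q \<cdot> x\<close> would enlarge it.\<close>

lemma orthonormal_basis_of_projection:
  fixes Q :: "'a::complex_hilbert_space bop"
  assumes Q: "Q\<^sup>* = Q" "Q * Q = Q"
  obtains B where "orthonormal B" "\<And>b. b \<in> B \<Longrightarrow> Q \<cdot> b = b"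
    "\<And>x. (\<And>b. b \<in> B \<Longrightarrow> \<langle>x, b\<rangle> = 0) \<Longrightarrow> Q \<cdot> x = 0"
proof -
  define \<A> where "\<A> = {B. orthonormal B \<and> (\<forall>b\<in>B. Q \<cdot> b = b)}"
  have "\<Union>C \<in> \<A>" if C: "subset.chain \<A> C" for C
  proof -
    have "\<langle>x, y\<rangle> = (if x = y then 1 else 0)" if xy: "x \<in> X" "X \<in> C" "y \<in> Y" "Y \<in> C" for x y X Y
    proof -
      have "X \<subseteq> Y \<or> Y \<subseteq> X" using C xy by (simp add: subset_chain_def)
      then obtain Z where "Z \<in> C" "x \<in> Z" "y \<in> Z" using xy by blast
      moreover from this have "orthonormal Z" using C by (auto simp: subset_chain_def \<A>_def)
      ultimately show ?thesis by (simp add: orthonormal_def)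
    qed
    then have "orthonormal (\<Union>C)" unfolding orthonormal_def by blast
    moreover have "\<forall>b\<in>\<Union>C. Q \<cdot> b = b" using C by (auto simp: subset_chain_def \<A>_def)
    ultimately show ?thesis by (simp add: \<A>_def)
  qed
  from subset_Zorn' [OF this] obtain B where "B \<in> \<A>" and max: "\<And>X. X \<in> \<A> \<Longrightarrow> B \<subseteq> X \<Longrightarrow> X = B"
    by blast
  then have B: "orthonormal B" and QB: "\<And>b. b \<in> B \<Longrightarrow> Q \<cdot> b = b" by (auto simp: \<A>_def)
  have "Q \<cdot> x = 0" if x: "\<And>b. b \<in> B \<Longrightarrow> \<langle>x, b\<rangle> = 0" for x
  proof (rule ccontr)
    assume nz: "Q \<cdot> x \<noteq> 0"
    define y where "y = inverse (norm (Q \<cdot> x)) *\<^sub>R (Q \<cdot> x)"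
    have yy: "\<langle>y, y\<rangle> = 1" unfolding y_def by (rule cinner_normalize [OF nz])
    have Qy: "Q \<cdot> y = y"
      using Q(2) by (simp add: y_def bop_apply_linear flip: bop_apply_simps(7))
    have yb: "\<langle>y, b\<rangle> = 0" if "b \<in> B" for b
      using x [OF that] cinner_adj_left [of Q x b] QB [OF that] by (simp add: y_def cinner_simps Q)
    have "insert y B \<in> \<A>"
      using B QB Qy yy yb cinner_eq_zero_sym [of y] by (auto simp: \<A>_def orthonormal_def)
    then have "y \<in> B" using max [of "insert y B"] by blast
    then show False using yb [of y] yy by simp
  qed
  with B QB that show ?thesis by blast
qed

text \<open>The operators agree on a closed subspace containing \<open>B\<close>; the rest of a
  vector is orthogonal to \<open>B\<close> and falls under \<open>perp\<close>.\<close>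

lemma bop_eq_on_orthonormal:
  fixes A C :: "'a::complex_hilbert_space bop"
  assumes B: "\<And>b. b \<in> B \<Longrightarrow> A \<cdot> b = C \<cdot> b"
    and perp: "\<And>x. (\<And>b. b \<in> B \<Longrightarrow> \<langle>x, b\<rangle> = 0) \<Longrightarrow> A \<cdot> x = C \<cdot> x"
  shows "A = C"
proof (rule bop_eqI)
  fix x
  define K where "K = {x. (A - C) \<cdot> x = 0}"
  have K: "complex_vector.subspace K"
    by (auto simp: K_def complex_vector.subspace_def bop_apply_linear simp flip: bop_apply_simps(4))
  have "closed K"
    unfolding K_def
    by (intro closed_Collect_eq bounded_linear.continuous_on [OF bounded_linear_bop_apply]
        continuous_intros)
  obtain k where k: "k \<in> K" "\<And>y. y \<in> K \<Longrightarrow> \<langle>x - k, y\<rangle> = 0"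
    using orthogonal_decomposition [OF K \<open>closed K\<close>] by blast
  have "A \<cdot> (x - k) = C \<cdot> (x - k)"
    using k(2) B by (intro perp) (simp add: K_def)
  then show "A \<cdot> x = C \<cdot> x" using k(1) by (simp add: bop_apply_linear K_def)
qed

lemma Bessel_inequality:
  assumes F: "finite F" "orthonormal F"
  shows "(\<Sum>b\<in>F. (cmod \<langle>x, b\<rangle>)\<^sup>2) \<le> (norm x)\<^sup>2"
proof -
  define p where "p = (\<Sum>b\<in>F. \<langle>x, b\<rangle> *\<^sub>C b)"
  have pb: "\<langle>p, b\<rangle> = \<langle>x, b\<rangle>" if "b \<in> F" for b
  proof -
    have "\<langle>p, b\<rangle> = (\<Sum>c\<in>F. if c = b then \<langle>x, b\<rangle> else 0)"
      unfolding p_def cinner_sum_left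
      by (rule sum.cong) (auto simp: cinner_simps orthonormalD [OF F(2) _ that])
    then show ?thesis using that F(1) by simp
  qed
  have "\<langle>x, p\<rangle> = (\<Sum>b\<in>F. complex_of_real ((cmod \<langle>x, b\<rangle>)\<^sup>2))"
    unfolding p_def cinner_sum_right complex_norm_square by (simp add: cinner_simps mult.commute)
  then have xp: "\<langle>x, p\<rangle> = complex_of_real (\<Sum>b\<in>F. (cmod \<langle>x, b\<rangle>)\<^sup>2)" by simp
  have "\<langle>p, p\<rangle> = (\<Sum>b\<in>F. complex_of_real ((cmod \<langle>x, b\<rangle>)\<^sup>2))"
    unfolding complex_norm_square by (subst (2) p_def) (simp add: cinner_sum_right cinner_simps pb mult.commute)
  then have "complex_of_real ((norm p)\<^sup>2) = complex_of_real (\<Sum>b\<in>F. (cmod \<langle>x, b\<rangle>)\<^sup>2)"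
    by (simp add: cinner_self)
  then have "(norm p)\<^sup>2 = (\<Sum>b\<in>F. (cmod \<langle>x, b\<rangle>)\<^sup>2)" using of_real_eq_iff by blast
  moreover have "0 \<le> (norm (x - p))\<^sup>2" by simp
  ultimately show ?thesis by (simp add: norm_diff_square xp)
qed

text \<open>The operator is \<open>x \<mapsto> (\<Sum>b\<in>B. \<langle>x, b\<rangle> *\<^sub>C f b)\<close>; obtaining it from the sesquilinear form below
  only needs infinite sums of complex numbers.\<close>

lemma partial_isometry_of_inj:
  fixes B :: "'a::complex_hilbert_space set"
  assumes B: "orthonormal B" and f: "inj_on f B" "f ` B \<subseteq> B"
  obtains V where "\<And>b. b \<in> B \<Longrightarrow> V \<cdot> b = f b" "\<And>x. (\<And>b. b \<in> B \<Longrightarrow> \<langle>x, b\<rangle> = 0) \<Longrightarrow> V \<cdot> x = 0"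
    "\<And>b. b \<in> B \<Longrightarrow> V\<^sup>* \<cdot> f b = b" "\<And>x. (\<And>b. b \<in> B \<Longrightarrow> \<langle>x, f b\<rangle> = 0) \<Longrightarrow> V\<^sup>* \<cdot> x = 0"
proof -
  define g where "g x y b = \<langle>y, f b\<rangle> * \<langle>b, x\<rangle>" for x y b
  \<comment> \<open>Cauchy-Schwarz for finite sums, with Bessel's inequality for \<open>F\<close>
    and for its image under \<open>f\<close>. The bound is uniform in \<open>F\<close>, so it gives
    both the summability and the bound on \<open>\<beta>\<close>.\<close>
  have fin: "(\<Sum>b\<in>F. norm (g x y b)) \<le> norm x * norm y" if F: "finite F" "F \<subseteq> B" for F x y
  proof -
    have "(\<Sum>b\<in>F. (cmod \<langle>y, f b\<rangle>)\<^sup>2) = (\<Sum>c\<in>f ` F. (cmod \<langle>y, c\<rangle>)\<^sup>2)"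
      using inj_on_subset [OF f(1) F(2)] by (simp add: sum.reindex)
    also have "\<dots> \<le> (norm y)\<^sup>2"
      using F f(2) by (intro Bessel_inequality orthonormal_subset [OF B]) auto
    finally have 1: "L2_set (\<lambda>b. cmod \<langle>y, f b\<rangle>) F \<le> norm y"
      unfolding L2_set_def by (rule real_le_lsqrt [OF norm_ge_zero, rotated])
    have "(\<Sum>b\<in>F. (cmod \<langle>b, x\<rangle>)\<^sup>2) \<le> (norm x)\<^sup>2"
      using Bessel_inequality [OF F(1) orthonormal_subset [OF B F(2)], of x]
      by (subst cinner_commute) simp
    then have 2: "L2_set (\<lambda>b. cmod \<langle>b, x\<rangle>) F \<le> norm x"
      unfolding L2_set_def by (rule real_le_lsqrt [OF norm_ge_zero, rotated])
    have "(\<Sum>b\<in>F. norm (g x y b)) \<le> L2_set (\<lambda>b. cmod \<langle>y, f b\<rangle>) F * L2_set (\<lambda>b. cmod \<langle>b, x\<rangle>) F"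
      using L2_set_mult_ineq [of "\<lambda>b. cmod \<langle>y, f b\<rangle>" "\<lambda>b. cmod \<langle>b, x\<rangle>" F]
      by (simp add: g_def norm_mult)
    also have "\<dots> \<le> norm y * norm x"
      by (intro mult_mono 1 2 L2_set_nonneg norm_ge_zero)
    finally show ?thesis by (simp add: mult.commute)
  qed
  have abs: "(\<lambda>b. norm (g x y b)) summable_on B" for x y
    unfolding abs_summable_iff_bdd_above by (rule bdd_aboveI2 [where M = "norm x * norm y"]) (auto intro: fin)
  then have summ: "g x y summable_on B" for x y by (rule abs_summable_summable)
  define \<beta> where "\<beta> x y = infsum (g x y) B" for x y
  have \<beta>_bound: "cmod (\<beta> x y) \<le> norm x * norm y" for x y
    unfolding \<beta>_def
    by (rule order_trans [OF norm_infsum_bound [OF abs] infsum_le_finite_sums [OF abs fin]])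
  have \<beta>_add: "\<beta> x (y + z) = \<beta> x y + \<beta> x z" "\<beta> (x + y) z = \<beta> x z + \<beta> y z" for x y z
    unfolding \<beta>_def infsum_add [OF summ summ, symmetric]
    by (rule infsum_cong, simp add: g_def cinner_simps algebra_simps)+
  have \<beta>_scale: "\<beta> x (a *\<^sub>C y) = a * \<beta> x y" "\<beta> (a *\<^sub>C x) y = cnj a * \<beta> x y" for x y a
    unfolding \<beta>_def infsum_cmult_right [OF summ, symmetric]
    by (rule infsum_cong, simp add: g_def cinner_simps algebra_simps)+
  have "\<exists>z. \<forall>y. \<beta> x y = \<langle>y, z\<rangle>" for x
  proof -
    have "bounded_linear (\<beta> x)"
      by (rule bounded_linear_intro [where K = "norm x"])
        (simp_all add: \<beta>_add \<beta>_scale scaleR_scaleC scaleR_conv_of_real \<beta>_bound mult.commute [of "norm _" "norm x"])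
    then show ?thesis by (rule Riesz_representation) (auto simp: \<beta>_scale)
  qed
  then obtain v where v: "\<And>x y. \<beta> x y = \<langle>y, v x\<rangle>" by metis
  have "v (x + y) = v x + v y" "v (a *\<^sub>C x) = a *\<^sub>C v x" for a x y
    by (rule cinner_ext_right, simp add: \<beta>_add \<beta>_scale cinner_simps flip: v)+
  moreover have "norm (v x) \<le> 1 * norm x" for x
  proof -
    have "norm (v x) * norm (v x) = cmod (\<beta> x (v x))"
      by (simp add: v cinner_self norm_power power2_eq_square norm_mult)
    also have "\<dots> \<le> norm (v x) * norm x" using \<beta>_bound [of x "v x"] by (simp add: mult.commute)
    finally show ?thesis by (cases "norm (v x) = 0") (auto simp: mult_le_cancel_left)
  qed
  ultimately obtain V where "\<And>x. V \<cdot> x = v x" using bop_exists by metis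
  then have V: "\<langle>y, V \<cdot> x\<rangle> = infsum (g x y) B" for x y using v by (simp add: \<beta>_def)
  have Vb: "V \<cdot> b = f b" if b: "b \<in> B" for b
  proof (rule cinner_ext_right)
    fix y
    have "infsum (g b y) B = infsum (g b y) {b}"
      using b by (intro infsum_cong_neutral) (auto simp: g_def orthonormalD [OF B])
    then show "\<langle>y, V \<cdot> b\<rangle> = \<langle>y, f b\<rangle>"
      using b by (simp add: V g_def orthonormalD [OF B])
  qed
  have Vp: "V \<cdot> x = 0" if x: "\<And>b. b \<in> B \<Longrightarrow> \<langle>x, b\<rangle> = 0" for x
  proof (rule cinner_ext_right)
    fix y
    have "infsum (g x y) B = infsum (\<lambda>_. 0) B"
      using x cinner_eq_zero_sym by (intro infsum_cong) (fastforce simp: g_def)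
    then show "\<langle>y, V \<cdot> x\<rangle> = \<langle>y, 0\<rangle>" by (simp add: V)
  qed
  \<comment> \<open>The first hypothesis makes \<open>z\<close> itself an admissible
    \<open>x\<close> in the second.\<close>
  have ortho: "z = 0" if "\<And>b. b \<in> B \<Longrightarrow> \<langle>z, b\<rangle> = 0" "\<And>x. (\<And>b. b \<in> B \<Longrightarrow> \<langle>x, b\<rangle> = 0) \<Longrightarrow> \<langle>z, x\<rangle> = 0" for z
    using that(2) [of z] that(1) by simp
  have 1: "V\<^sup>* \<cdot> f b - b = 0" if b: "b \<in> B" for b
  proof (rule ortho)
    fix c assume c: "c \<in> B"
    have "\<langle>f b, f c\<rangle> = \<langle>b, c\<rangle>"
      using b c f by (auto simp: orthonormalD [OF B] inj_on_eq_iff image_subset_iff)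
    then show "\<langle>V\<^sup>* \<cdot> f b - b, c\<rangle> = 0"
      by (simp add: cinner_simps cinner_adj_left Vb c)
  next
    fix x assume x: "\<And>b. b \<in> B \<Longrightarrow> \<langle>x, b\<rangle> = 0"
    then show "\<langle>V\<^sup>* \<cdot> f b - b, x\<rangle> = 0"
      using x [OF b] by (simp add: cinner_simps cinner_adj_left Vp cinner_eq_zero_sym [of b])
  qed
  have 2: "V\<^sup>* \<cdot> x = 0" if x: "\<And>b. b \<in> B \<Longrightarrow> \<langle>x, f b\<rangle> = 0" for x
    by (rule ortho) (simp_all add: cinner_adj_left Vb x Vp)
  show ?thesis using that [of V] Vb Vp 1 2 by simp
qed

text \<open>Cardinal arithmetic, since a basis may be uncountable.\<close>

lemma infinite_bij_Plus: "infinite B \<Longrightarrow> \<exists>h. bij_betw h (B <+> B) B"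
  using card_of_Plus_infinite1 [OF _ card_of_mono1 [OF subset_refl], of B] by (simp add: card_of_ordIso)

text \<open>A bijection of two copies of the basis onto the basis carries the range of
  \<open>Q\<close> onto two complementary orthogonal halves of itself.\<close>

lemma halve_projection:
  fixes Q :: "'a::complex_hilbert_space bop"
  assumes B: "orthonormal B" and QB: "\<And>b. b \<in> B \<Longrightarrow> Q \<cdot> b = b"
    and Qp: "\<And>x. (\<And>b. b \<in> B \<Longrightarrow> \<langle>x, b\<rangle> = 0) \<Longrightarrow> Q \<cdot> x = 0"
    and "infinite B"
  obtains V W where "V\<^sup>* * V = Q" "W\<^sup>* * W = Q" "V\<^sup>* * W = 0" "V * V\<^sup>* + W * W\<^sup>* = Q"
proof -
  obtain h where h: "bij_betw h (B <+> B) B" using infinite_bij_Plus [OF \<open>infinite B\<close>] by blast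
  have hB: "h (Inl b) \<in> B" "h (Inr b) \<in> B" if "b \<in> B" for b
    using bij_betwE [OF h] that by auto
  have inj: "h (Inl b) = h (Inl c) \<longleftrightarrow> b = c" "h (Inr b) = h (Inr c) \<longleftrightarrow> b = c"
    "h (Inl b) \<noteq> h (Inr c)" "h (Inr b) \<noteq> h (Inl c)" if "b \<in> B" "c \<in> B" for b c
    using that by (simp_all add: inj_on_eq_iff [OF bij_betw_imp_inj_on [OF h]] InlI InrI)
  have surj: "\<exists>b\<in>B. c = h (Inl b) \<or> c = h (Inr b)" if "c \<in> B" for c
    using bij_betw_imp_surj_on [OF h] that by (auto elim!: PlusE)
  have perp: "\<langle>h (Inl b), h (Inr c)\<rangle> = 0" "\<langle>h (Inr b), h (Inl c)\<rangle> = 0" if "b \<in> B" "c \<in> B" for b c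
    using that by (simp_all add: inj orthonormalD [OF B hB(1) hB(2)] orthonormalD [OF B hB(2) hB(1)])
  obtain V where V: "\<And>b. b \<in> B \<Longrightarrow> V \<cdot> b = h (Inl b)"
    "\<And>x. (\<And>b. b \<in> B \<Longrightarrow> \<langle>x, b\<rangle> = 0) \<Longrightarrow> V \<cdot> x = 0"
    "\<And>b. b \<in> B \<Longrightarrow> V\<^sup>* \<cdot> h (Inl b) = b"
    "\<And>x. (\<And>b. b \<in> B \<Longrightarrow> \<langle>x, h (Inl b)\<rangle> = 0) \<Longrightarrow> V\<^sup>* \<cdot> x = 0"
    by (rule partial_isometry_of_inj [OF B, of "\<lambda>b. h (Inl b)"]) (auto simp: inj_on_def inj hB)
  obtain W where W: "\<And>b. b \<in> B \<Longrightarrow> W \<cdot> b = h (Inr b)"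
    "\<And>x. (\<And>b. b \<in> B \<Longrightarrow> \<langle>x, b\<rangle> = 0) \<Longrightarrow> W \<cdot> x = 0"
    "\<And>b. b \<in> B \<Longrightarrow> W\<^sup>* \<cdot> h (Inr b) = b"
    "\<And>x. (\<And>b. b \<in> B \<Longrightarrow> \<langle>x, h (Inr b)\<rangle> = 0) \<Longrightarrow> W\<^sup>* \<cdot> x = 0"
    by (rule partial_isometry_of_inj [OF B, of "\<lambda>b. h (Inr b)"]) (auto simp: inj_on_def inj hB)
  show ?thesis
  proof
    show "V\<^sup>* * V = Q" "W\<^sup>* * W = Q" "V\<^sup>* * W = 0"
      by (rule bop_eq_on_orthonormal [of B]; simp add: V W QB Qp bop_apply_linear perp)+
    show "V * V\<^sup>* + W * W\<^sup>* = Q"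
    proof (rule bop_eq_on_orthonormal [of B])
      fix c assume c: "c \<in> B"
      from surj [OF c] obtain b where b: "b \<in> B" "c = h (Inl b) \<or> c = h (Inr b)" by blast
      then show "(V * V\<^sup>* + W * W\<^sup>*) \<cdot> c = Q \<cdot> c"
        using QB [OF c] by (auto simp: V W perp bop_apply_linear)
    next
      fix x assume "\<And>b. b \<in> B \<Longrightarrow> \<langle>x, b\<rangle> = 0"
      then show "(V * V\<^sup>* + W * W\<^sup>*) \<cdot> x = Q \<cdot> x"
        by (simp add: V(4) W(4) Qp hB bop_apply_linear)
    qed
  qed
qed

lemma finite_projection_eq_sum:
  fixes Q :: "'a::complex_hilbert_space bop"
  assumes "orthonormal B" "finite B" and QB: "\<And>b. b \<in> B \<Longrightarrow> Q \<cdot> b = b"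
    and Qp: "\<And>x. (\<And>b. b \<in> B \<Longrightarrow> \<langle>x, b\<rangle> = 0) \<Longrightarrow> Q \<cdot> x = 0"
  shows "Q = (\<Sum>b\<in>B. rank_one b b)"
proof (rule bop_eq_on_orthonormal [of B])
  fix c assume c: "c \<in> B"
  have "(\<Sum>b\<in>B. rank_one b b \<cdot> c) = (\<Sum>b\<in>B. if b = c then c else 0)"
    using c by (intro sum.cong) (auto simp: orthonormalD [OF assms(1) c] scaleC_one)
  then show "Q \<cdot> c = (\<Sum>b\<in>B. rank_one b b) \<cdot> c"
    using c assms(2) by (simp add: bop_apply_sum QB)
qed (simp add: bop_apply_sum Qp)

text \<open>The identity is halved; a finite orthonormal basis would span the space.
  \<open>S\<close> and \<open>T\<close> satisfy the Cuntz relations.\<close>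

lemma infinite_dimensional_halving:
  assumes "\<nexists>S :: 'a::complex_hilbert_space set. finite S \<and> complex_vector.span S = UNIV"
  obtains S T :: "'a::complex_hilbert_space bop" where "S\<^sup>* * S = 1" "T\<^sup>* * T = 1" "S\<^sup>* * T = 0" "S * S\<^sup>* + T * T\<^sup>* = 1"
proof -
  obtain B :: "'a set" where B: "orthonormal B" "\<And>b. b \<in> B \<Longrightarrow> 1 \<cdot> b = b"
    "\<And>x. (\<And>b. b \<in> B \<Longrightarrow> \<langle>x, b\<rangle> = 0) \<Longrightarrow> 1 \<cdot> x = 0"
    using orthonormal_basis_of_projection [of 1] by (metis adj_simps(7) mult_1)
  have "infinite B"
  proof
    assume fin: "finite B"
    have "1 = (\<Sum>b\<in>B. rank_one b b)" by (rule finite_projection_eq_sum [OF B(1) fin B(2,3)])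
    then have "x = (\<Sum>b\<in>B. \<langle>x, b\<rangle> *\<^sub>C b)" for x
      by (metis (no_types, lifting) bop_apply_simps(2) bop_apply_sum rank_one_apply sum.cong)
    then have "x \<in> complex_vector.span B" for x
      by (rule ssubst)
        (intro complex_vector.span_sum complex_vector.span_scale complex_vector.span_base)
    then show False using assms fin by blast
  qed
  from halve_projection [OF B(1) B(2,3) this] that show ?thesis by metis
qed

subsection \<open>Linear and conjugate-linear maps preserving isometries and coisometries\<close>

text \<open>Multiplied by \<open>z\<close>, the isometry condition on the unit circle is a quadratic
  polynomial in \<open>z\<close> with coefficients \<open>P\<close>, \<open>G\<close> and
  \<open>R\<close>; three distinct roots make it vanish.\<close>

lemma pencil_isometries:
  fixes M N :: "'a::complex_hilbert_space bop"
  assumes z: "z1 \<noteq> z2" "z1 \<noteq> z3" "z2 \<noteq> z3"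
    and iso: "\<And>z. z \<in> {z1, z2, z3} \<Longrightarrow> cmod z = 1 \<and> (M + z *\<^sub>C N)\<^sup>* * (M + z *\<^sub>C N) = 1"
  shows "M\<^sup>* * N = 0 \<and> M\<^sup>* * M + N\<^sup>* * N = 1"
proof -
  define G where "G = M\<^sup>* * M + N\<^sup>* * N - 1"
  define P where "P = M\<^sup>* * N"
  define R where "R = N\<^sup>* * M"
  have eq: "z *\<^sub>C G + (z * z) *\<^sub>C P + R = 0" if "z \<in> {z1, z2, z3}" for z
  proof -
    have z: "z * cnj z = 1" using iso [OF that] by (simp add: norm_of_unit_phase)
    have "z *\<^sub>C ((M + z *\<^sub>C N)\<^sup>* * (M + z *\<^sub>C N) - 1) = 0"
      using iso [OF that] by simp
    then show ?thesis
      by (simp add: G_def P_def R_def algebra_simps scaleC_add_right scaleC_scaleC z scaleC_one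
          complex_vector.scale_right_diff_distrib)
  qed
  \<comment> \<open>A divided difference at two roots lowers the degree by one.\<close>
  have sub: "G + (a + b) *\<^sub>C P = 0" if ab: "a \<in> {z1, z2, z3}" "b \<in> {z1, z2, z3}" "a \<noteq> b" for a b
  proof -
    have "(a - b) *\<^sub>C (G + (a + b) *\<^sub>C P)
        = (a *\<^sub>C G + (a * a) *\<^sub>C P + R) - (b *\<^sub>C G + (b * b) *\<^sub>C P + R)"
      by (simp add: scaleC_add_right scaleC_scaleC algebra_simps complex_vector.scale_left_diff_distrib
          flip: scaleC_add_left)
    also have "\<dots> = 0" by (simp only: eq [OF ab(1)] eq [OF ab(2)]) simp
    finally show ?thesis using ab(3) by (simp add: complex_vector.scale_eq_0_iff)
  qed
  have "(z2 - z3) *\<^sub>C P = (G + (z1 + z2) *\<^sub>C P) - (G + (z1 + z3) *\<^sub>C P)"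
    by (simp add: complex_vector.scale_left_diff_distrib scaleC_add_left)
  also have "\<dots> = 0" using sub [of z1 z2] sub [of z1 z3] z by simp
  finally have "P = 0" using z(3) by (simp add: complex_vector.scale_eq_0_iff)
  then have "G = 0" using sub [of z1 z2] z by simp
  with \<open>P = 0\<close> show ?thesis by (simp add: G_def P_def)
qed

text \<open>Of five points on the unit circle, three lead to isometries or three lead to coisometries.\<close>

lemma pencil_extreme:
  fixes M N :: "'a::complex_hilbert_space bop"
  assumes ext: "\<And>z. cmod z = 1 \<Longrightarrow> (M + z *\<^sub>C N)\<^sup>* * (M + z *\<^sub>C N) = 1 \<or> (M + z *\<^sub>C N) * (M + z *\<^sub>C N)\<^sup>* = 1"
  shows "M\<^sup>* * N = 0 \<and> M\<^sup>* * M + N\<^sup>* * N = 1 \<or> M * N\<^sup>* = 0 \<and> M * M\<^sup>* + N * N\<^sup>* = 1"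
proof -
  \<comment> \<open>The fifth point comes from the Pythagorean triple 3, 4, 5, so its modulus is
    found by rational arithmetic.\<close>
  define Z where "Z = {1, -1, \<i>, -\<i>, Complex (3/5) (4/5)}"
  have Z: "cmod z = 1" if "z \<in> Z" for z
    using that by (auto simp: Z_def cmod_def power2_eq_square)
  have cardZ: "card Z = 5" "finite Z" by (auto simp: Z_def complex_eq_iff card_insert_if)
  define I where "I = {z \<in> Z. (M + z *\<^sub>C N)\<^sup>* * (M + z *\<^sub>C N) = 1}"
  define C where "C = {z \<in> Z. (M + z *\<^sub>C N) * (M + z *\<^sub>C N)\<^sup>* = 1}"
  have "Z = I \<union> C" using ext Z by (auto simp: I_def C_def)
  then have "5 \<le> card I + card C" using card_Un_le [of I C] cardZ by simp
  then have "3 \<le> card I \<or> 3 \<le> card C" by linarith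
  then show ?thesis
  proof
    assume "3 \<le> card I"
    then obtain F where "F \<subseteq> I" "card F = 3" by (metis obtain_subset_with_card_n)
    then obtain z1 z2 z3 where z: "z1 \<noteq> z2" "z1 \<noteq> z3" "z2 \<noteq> z3" "{z1, z2, z3} \<subseteq> I"
      by (metis card_3_iff)
    have "M\<^sup>* * N = 0 \<and> M\<^sup>* * M + N\<^sup>* * N = 1"
      by (rule pencil_isometries [OF z(1,2,3)]) (use z(4) Z in \<open>auto simp: I_def\<close>)
    then show ?thesis ..
  next
    assume "3 \<le> card C"
    then obtain F where "F \<subseteq> C" "card F = 3" by (metis obtain_subset_with_card_n)
    then obtain z1 z2 z3 where z: "z1 \<noteq> z2" "z1 \<noteq> z3" "z2 \<noteq> z3" "{z1, z2, z3} \<subseteq> C"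
      by (metis card_3_iff)
    \<comment> \<open>The adjoint of \<open>M + z *\<^sub>C N\<close> is the pencil of the adjoints
      at \<open>cnj z\<close>.\<close>
    have "(M\<^sup>*)\<^sup>* * N\<^sup>* = 0 \<and> (M\<^sup>*)\<^sup>* * M\<^sup>* + (N\<^sup>*)\<^sup>* * N\<^sup>* = 1"
      by (rule pencil_isometries [of "cnj z1" "cnj z2" "cnj z3"])
        (use z Z in \<open>auto simp: C_def\<close>)
    then show ?thesis by simp
  qed
qed

text \<open>The squared norms of \<open>A \<cdot> x\<close> and \<open>B \<cdot> x\<close> are at
  most that of \<open>x\<close> and add up to twice it, so both are equal to it.\<close>

lemma isometries_of_sum:
  assumes nA: "norm A \<le> 1" and nB: "norm B \<le> 1" and sum: "A\<^sup>* * A + B\<^sup>* * B = 2 *\<^sub>R 1"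
  shows "A\<^sup>* * A = 1 \<and> B\<^sup>* * B = 1"
proof -
  have "norm (A \<cdot> x) = norm x \<and> norm (B \<cdot> x) = norm x" for x
  proof -
    have "complex_of_real ((norm (A \<cdot> x))\<^sup>2 + (norm (B \<cdot> x))\<^sup>2) = \<langle>(A\<^sup>* * A + B\<^sup>* * B) \<cdot> x, x\<rangle>"
      unfolding of_real_add norm_bop_apply_square by (simp add: cinner_simps)
    also have "\<dots> = complex_of_real (2 * (norm x)\<^sup>2)" by (simp add: sum cinner_simps cinner_self)
    finally have "(norm (A \<cdot> x))\<^sup>2 + (norm (B \<cdot> x))\<^sup>2 = 2 * (norm x)\<^sup>2" using of_real_eq_iff by blast
    moreover have "(norm (A \<cdot> x))\<^sup>2 \<le> (norm x)\<^sup>2" "(norm (B \<cdot> x))\<^sup>2 \<le> (norm x)\<^sup>2"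
      using norm_bop_apply_le nA nB by (auto intro: power_mono)
    ultimately have "(norm (A \<cdot> x))\<^sup>2 = (norm x)\<^sup>2" "(norm (B \<cdot> x))\<^sup>2 = (norm x)\<^sup>2" by linarith+
    then show ?thesis by (simp add: power2_eq_iff_nonneg)
  qed
  then show ?thesis by (simp add: isometry_iff)
qed

lemma norm_extreme: "A\<^sup>* * A = 1 \<or> A * A\<^sup>* = 1 \<Longrightarrow> norm A \<le> 1"
  using norm_isometry [of A] norm_isometry [of "A\<^sup>*"] by auto

section \<open>Extreme-point preservers, linear or conjugate-linear\<close>

locale semilinear_bop_map =
  fixes \<Psi> :: "'a::complex_hilbert_space bop \<Rightarrow> 'a bop" and \<sigma> :: "complex \<Rightarrow> complex"
  assumes add: "\<Psi> (A + B) = \<Psi> A + \<Psi> B"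
    and scaleC: "\<Psi> (c *\<^sub>C A) = \<sigma> c *\<^sub>C \<Psi> A"
    and \<sigma>: "\<sigma> = (\<lambda>c. c) \<or> \<sigma> = cnj"
begin

lemma \<sigma>_simps [simp]: "\<sigma> (of_real r) = of_real r" "\<sigma> (\<sigma> c) = c" "cmod (\<sigma> c) = cmod c" "\<sigma> (cnj c) = cnj (\<sigma> c)"
  using \<sigma> by auto

lemma scaleR: "\<Psi> (r *\<^sub>R A) = r *\<^sub>R \<Psi> A"
  by (simp add: scaleR_scaleC scaleC)

lemma zero: "\<Psi> 0 = 0"
  using scaleR [of 0 0] by simp

lemma minus: "\<Psi> (- A) = - \<Psi> A"
  using scaleR [of "-1" A] by simp

lemma diff: "\<Psi> (A - B) = \<Psi> A - \<Psi> B"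
  using add [of A "- B"] by (simp add: minus)

lemma sum: "\<Psi> (\<Sum>i\<in>I. f i) = (\<Sum>i\<in>I. \<Psi> (f i))"
  by (induction I rule: infinite_finite_induct) (auto simp: add zero)

end

text \<open>\<open>S\<close> and \<open>T\<close> identify the space with its own double.\<close>

locale extreme_preserver = semilinear_bop_map \<Psi> \<sigma>
  for \<Psi> :: "'a::complex_hilbert_space bop \<Rightarrow> 'a bop" and \<sigma> +
  fixes S T :: "'a bop"
  assumes ext: "A\<^sup>* * A = 1 \<or> A * A\<^sup>* = 1 \<Longrightarrow> (\<Psi> A)\<^sup>* * \<Psi> A = 1 \<or> \<Psi> A * (\<Psi> A)\<^sup>* = 1"
    and ST: "S\<^sup>* * S = 1" "T\<^sup>* * T = 1" "S\<^sup>* * T = 0" "S * S\<^sup>* + T * T\<^sup>* = 1"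
begin

lemma TS: "T\<^sup>* * S = 0"
  using arg_cong [OF ST(3), of adj] by simp

lemma ST_left: "S\<^sup>* * (S * A) = A" "T\<^sup>* * (T * A) = A" "S\<^sup>* * (T * A) = 0" "T\<^sup>* * (S * A) = 0"
  by (simp_all add: ST TS flip: mult.assoc)

text \<open>\<open>X + z *\<^sub>C Y\<close> divided by \<open>sqrt 2\<close> is an isometry for
  unimodular \<open>z\<close>, so \<open>pencil_extreme\<close> applies to the scaled images. As the
  images are contractions, the resulting sum relation splits by
  \<open>isometries_of_sum\<close>.\<close>

lemma orthogonal_isometries:
  assumes XY: "X\<^sup>* * X = 1" "Y\<^sup>* * Y = 1" "X\<^sup>* * Y = 0"
  shows "(\<Psi> X)\<^sup>* * \<Psi> X = 1 \<and> (\<Psi> Y)\<^sup>* * \<Psi> Y = 1 \<and> (\<Psi> X)\<^sup>* * \<Psi> Y = 0 \<or>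
    \<Psi> X * (\<Psi> X)\<^sup>* = 1 \<and> \<Psi> Y * (\<Psi> Y)\<^sup>* = 1 \<and> \<Psi> X * (\<Psi> Y)\<^sup>* = 0"
proof -
  define r where "r = 1 / sqrt 2"
  have r: "r * r = 1/2" "r \<noteq> 0" by (simp_all add: r_def)
  have YX: "Y\<^sup>* * X = 0" using arg_cong [OF XY(3), of adj] by simp
  have comb: "(a *\<^sub>C X + b *\<^sub>C Y)\<^sup>* * (a *\<^sub>C X + b *\<^sub>C Y) = (cnj a * a + cnj b * b) *\<^sub>C 1" for a b
    by (simp add: XY YX algebra_simps scaleC_scaleC scaleC_add_left)
  define M where "M = r *\<^sub>R \<Psi> X"
  define N where "N = r *\<^sub>R \<Psi> Y"
  have "(M + z *\<^sub>C N)\<^sup>* * (M + z *\<^sub>C N) = 1 \<or> (M + z *\<^sub>C N) * (M + z *\<^sub>C N)\<^sup>* = 1" if z: "cmod z = 1" for z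
  proof -
    define a where "a = complex_of_real r"
    \<comment> \<open>The coefficient contains \<open>\<sigma> z\<close> because
      \<open>\<Psi>\<close> applies \<open>\<sigma>\<close> once more and \<open>\<sigma>\<close> is
      an involution.\<close>
    define A where "A = a *\<^sub>C X + (a * \<sigma> z) *\<^sub>C Y"
    have "cnj a * a = of_real (r * r)" by (simp add: a_def)
    then have a: "cnj a * a = 1/2" by (simp add: r)
    have "\<sigma> z * cnj (\<sigma> z) = 1" using z by (simp add: norm_of_unit_phase)
    then have "cnj (a * \<sigma> z) * (a * \<sigma> z) = cnj a * a" by (simp add: algebra_simps)
    then have "A\<^sup>* * A = 1"
      unfolding A_def comb by (simp only: a) (simp add: scaleC_one)
    moreover have "\<Psi> A = M + z *\<^sub>C N"
    proof -
      have "\<sigma> a = a" "\<sigma> (a * \<sigma> z) = z * a" using \<sigma> by (auto simp: a_def)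
      then show ?thesis by (simp add: A_def M_def N_def add scaleC scaleR_scaleC scaleC_scaleC a_def)
    qed
    ultimately show ?thesis using ext [of A] by simp
  qed
  from pencil_extreme [OF this] show ?thesis
  proof
    assume MN: "M\<^sup>* * N = 0 \<and> M\<^sup>* * M + N\<^sup>* * N = 1"
    then have 1: "(\<Psi> X)\<^sup>* * \<Psi> Y = 0" by (simp add: M_def N_def r)
    have "(\<Psi> X)\<^sup>* * \<Psi> X + (\<Psi> Y)\<^sup>* * \<Psi> Y = 2 *\<^sub>R (M\<^sup>* * M + N\<^sup>* * N)"
      by (simp add: M_def N_def r scaleR_add_right)
    then show ?thesis
      using isometries_of_sum [of "\<Psi> X" "\<Psi> Y"] norm_extreme [OF ext] XY 1 MN by simp
  next
    assume MN: "M * N\<^sup>* = 0 \<and> M * M\<^sup>* + N * N\<^sup>* = 1"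
    then have 1: "\<Psi> X * (\<Psi> Y)\<^sup>* = 0" by (simp add: M_def N_def r)
    have "\<Psi> X * (\<Psi> X)\<^sup>* + \<Psi> Y * (\<Psi> Y)\<^sup>* = 2 *\<^sub>R (M * M\<^sup>* + N * N\<^sup>*)"
      by (simp add: M_def N_def r scaleR_add_right)
    then show ?thesis
      using isometries_of_sum [of "(\<Psi> X)\<^sup>*" "(\<Psi> Y)\<^sup>*"] norm_extreme [OF ext] XY 1 MN by simp
  qed
qed

text \<open>In the coisometric alternative \<open>\<Psi> X\<close> would be unitary, so the
  coisometry \<open>\<Psi> Y\<close> would vanish. This happens only on the zero space, where all
  operators are equal.\<close>

lemma orthogonal_to_isometry:
  assumes XY: "X\<^sup>* * X = 1" "Y\<^sup>* * Y = 1" "X\<^sup>* * Y = 0" and X: "(\<Psi> X)\<^sup>* * \<Psi> X = 1"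
  shows "(\<Psi> Y)\<^sup>* * \<Psi> Y = 1 \<and> (\<Psi> X)\<^sup>* * \<Psi> Y = 0"
  using orthogonal_isometries [OF XY]
proof
  assume co: "\<Psi> X * (\<Psi> X)\<^sup>* = 1 \<and> \<Psi> Y * (\<Psi> Y)\<^sup>* = 1 \<and> \<Psi> X * (\<Psi> Y)\<^sup>* = 0"
  have "(\<Psi> Y)\<^sup>* = (\<Psi> X)\<^sup>* * (\<Psi> X * (\<Psi> Y)\<^sup>*)" by (simp add: X flip: mult.assoc)
  then have "(1 :: 'a bop) = 0" using co by simp
  then have "A = B" for A B :: "'a bop" by (metis mult_1 mult_zero_left)
  then show ?thesis by blast
qed simp

text \<open>The sesquilinear form on the left is block diagonal for the decomposition given by
  \<open>S\<close> and \<open>T\<close>, and each block depends only on the product of the adjoint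
  of the first argument with the second.\<close>

lemma isometric_multiplicative:
  assumes iso: "(\<Psi> S)\<^sup>* * \<Psi> S = 1"
  shows "(\<Psi> X)\<^sup>* * \<Psi> Y = (\<Psi> 1)\<^sup>* * \<Psi> (X\<^sup>* * Y) \<and> (\<Psi> 1)\<^sup>* * \<Psi> 1 = 1"
proof -
  \<comment> \<open>Isometry spreads from \<open>S\<close> to all \<open>T * U\<close>, whose ranges
    are orthogonal to that of \<open>S\<close>, and from \<open>T\<close> back to all
    \<open>S * U\<close>.\<close>
  have isoT: "(\<Psi> (T * U))\<^sup>* * \<Psi> (T * U) = 1" if "U\<^sup>* * U = 1" for U
    using orthogonal_to_isometry [of S "T * U"] iso that by (simp add: ST ST_left mult.assoc)
  have isoS: "(\<Psi> (S * U))\<^sup>* * \<Psi> (S * U) = 1" if "U\<^sup>* * U = 1" for U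
    using orthogonal_to_isometry [of T "S * U"] isoT [of 1] that
    by (simp add: ST ST_left mult.assoc)
  have orth1: "(\<Psi> (S * U))\<^sup>* * \<Psi> (T * V) = 0" if "U\<^sup>* * U = 1" "V\<^sup>* * V = 1" for U V
    using orthogonal_to_isometry [of "S * U" "T * V"] isoS [OF that(1)] that
    by (simp add: ST_left mult.assoc)
  \<comment> \<open>A property closed under sums and scalar multiples in each argument need only be
    checked on isometries, as the unitaries among them span.\<close>
  have bilinear: "P X Y" if "\<And>U V. U\<^sup>* * U = 1 \<Longrightarrow> V\<^sup>* * V = 1 \<Longrightarrow> P U V"
    "\<And>X X' Y. P X Y \<Longrightarrow> P X' Y \<Longrightarrow> P (X + X') Y" "\<And>X Y Y'. P X Y \<Longrightarrow> P X Y' \<Longrightarrow> P X (Y + Y')"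
    "\<And>c X Y. P X Y \<Longrightarrow> P (c *\<^sub>C X) Y" "\<And>c X Y. P X Y \<Longrightarrow> P X (c *\<^sub>C Y)"
    for P and X Y :: "'a bop"
  proof -
    have "P U Y" if "U\<^sup>* * U = 1" for U
      by (induction Y rule: bop_induct_unitary) (use that \<open>\<And>U V. U\<^sup>* * U = 1 \<Longrightarrow> V\<^sup>* * V = 1 \<Longrightarrow> P U V\<close>
          \<open>\<And>X Y Y'. P X Y \<Longrightarrow> P X Y' \<Longrightarrow> P X (Y + Y')\<close> \<open>\<And>c X Y. P X Y \<Longrightarrow> P X (c *\<^sub>C Y)\<close> in blast)+
    then show ?thesis
      by (induction X rule: bop_induct_unitary)
        (use \<open>\<And>X X' Y. P X Y \<Longrightarrow> P X' Y \<Longrightarrow> P (X + X') Y\<close> \<open>\<And>c X Y. P X Y \<Longrightarrow> P (c *\<^sub>C X) Y\<close> in blast)+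
  qed
  have orth: "(\<Psi> (S * X))\<^sup>* * \<Psi> (T * Y) = 0" for X Y
    by (rule bilinear [of _ X Y]) (auto simp: orth1 add scaleC algebra_simps)
  have orth': "(\<Psi> (T * X))\<^sup>* * \<Psi> (S * Y) = 0" for X Y
    using arg_cong [OF orth, of adj Y X] by simp
  have twist: "(\<Psi> (S * X))\<^sup>* * \<Psi> (S * Y) = (\<Psi> (T * (U * X)))\<^sup>* * \<Psi> (T * (U * Y))"
    if U: "U\<^sup>* * U = 1" for U X Y
  proof (rule bilinear [of _ X Y])
    fix X Y :: "'a bop"
    assume X: "X\<^sup>* * X = 1" and Y: "Y\<^sup>* * Y = 1"
    define r where "r = 1 / sqrt 2"
    have r: "r * r = 1/2" "r \<noteq> 0" by (simp_all add: r_def)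
    have UL: "U\<^sup>* * (U * A) = A" "X\<^sup>* * (X * A) = A" for A
      using U X by (simp_all flip: mult.assoc)
    \<comment> \<open>\<open>P\<close> and \<open>M\<close> are isometries with orthogonal ranges,
      and so are their images. Since the cross terms vanish by \<open>orth\<close> and
      \<open>orth'\<close>, this orthogonality equates the two blocks.\<close>
    define P where "P = r *\<^sub>R (S * X + T * (U * X))"
    define M where "M = r *\<^sub>R (S * Y - T * (U * Y))"
    have 1: "P\<^sup>* * P = 1" "M\<^sup>* * M = 1" "P\<^sup>* * M = 0"
      by (simp_all add: P_def M_def algebra_simps ST_left UL X Y r flip: scaleR_2)
    have "(U * X)\<^sup>* * (U * X) = 1" by (simp add: mult.assoc UL X)
    then have "(\<Psi> P)\<^sup>* * \<Psi> P = 1"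
      by (simp add: P_def scaleR add algebra_simps orth orth' isoS isoT X r flip: scaleR_2)
    then have "(\<Psi> P)\<^sup>* * \<Psi> M = 0" using orthogonal_to_isometry [OF 1] by simp
    then show "(\<Psi> (S * X))\<^sup>* * \<Psi> (S * Y) = (\<Psi> (T * (U * X)))\<^sup>* * \<Psi> (T * (U * Y))"
      using r by (simp add: P_def M_def scaleR add diff algebra_simps orth orth')
  qed (auto simp: add scaleC algebra_simps)
  define k where "k A = (\<Psi> S)\<^sup>* * \<Psi> (S * A)" for A
  have swap: "(\<Psi> (T * X))\<^sup>* * \<Psi> (T * Y) = (\<Psi> (S * X))\<^sup>* * \<Psi> (S * Y)" for X Y
    using twist [of 1 X Y] by simp
  have kS: "(\<Psi> (S * X))\<^sup>* * \<Psi> (S * Y) = k (X\<^sup>* * Y)" for X Y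
  proof (induction X rule: bop_induct_unitary)
    case (unitary U)
    \<comment> \<open>Unitarity matters here: with \<open>U * U\<^sup>* = 1\<close>,
      \<open>twist\<close> moves \<open>U\<close> from one argument to the other.\<close>
    have "U * (U\<^sup>* * Y) = Y" using unitary by (simp flip: mult.assoc)
    then show ?case using twist [OF unitary(1), of 1 "U\<^sup>* * Y"] by (simp add: k_def swap)
  qed (simp_all add: k_def add scaleC algebra_simps)
  have kPsi: "(\<Psi> X)\<^sup>* * \<Psi> Y = k (X\<^sup>* * Y)" for X Y
  proof -
    have split: "Z = S * (S\<^sup>* * Z) + T * (T\<^sup>* * Z)" for Z
      using ST(4) by (simp flip: mult.assoc distrib_right)
    have "(\<Psi> X)\<^sup>* * \<Psi> Y = k ((S\<^sup>* * X)\<^sup>* * (S\<^sup>* * Y)) + k ((T\<^sup>* * X)\<^sup>* * (T\<^sup>* * Y))"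
      by (subst split [of X], subst split [of Y]) (simp only: add adj_simps(1) distrib_left distrib_right orth orth' swap kS, simp)
    also have "\<dots> = k ((S\<^sup>* * X)\<^sup>* * (S\<^sup>* * Y) + (T\<^sup>* * X)\<^sup>* * (T\<^sup>* * Y))"
      by (simp add: k_def add distrib_left)
    also have "(S\<^sup>* * X)\<^sup>* * (S\<^sup>* * Y) + (T\<^sup>* * X)\<^sup>* * (T\<^sup>* * Y) = X\<^sup>* * Y"
      by (subst (3) split [of Y]) (simp add: algebra_simps)
    finally show ?thesis .
  qed
  have "k 1 = 1" using iso by (simp add: k_def)
  then show ?thesis using kPsi [of X Y] kPsi [of 1 "X\<^sup>* * Y"] kPsi [of 1 1] by simp
qed

lemma extreme_preserver_adj: "extreme_preserver (\<lambda>A. (\<Psi> A)\<^sup>*) (cnj \<circ> \<sigma>) S T"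
proof
  show "cnj \<circ> \<sigma> = (\<lambda>c. c) \<or> cnj \<circ> \<sigma> = cnj" using \<sigma> by (auto simp: fun_eq_iff)
  show "((\<Psi> A)\<^sup>*)\<^sup>* * (\<Psi> A)\<^sup>* = 1 \<or> (\<Psi> A)\<^sup>* * ((\<Psi> A)\<^sup>*)\<^sup>* = 1" if "A\<^sup>* * A = 1 \<or> A * A\<^sup>* = 1" for A
    using ext [OF that] unfolding adj_adj by blast
qed (simp_all add: add scaleC ST)

lemma extreme_preserver_comp_adj: "extreme_preserver (\<lambda>A. \<Psi> (A\<^sup>*)) (\<sigma> \<circ> cnj) S T"
proof
  show "\<sigma> \<circ> cnj = (\<lambda>c. c) \<or> \<sigma> \<circ> cnj = cnj" using \<sigma> by (auto simp: fun_eq_iff)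
  show "(\<Psi> (A\<^sup>*))\<^sup>* * \<Psi> (A\<^sup>*) = 1 \<or> \<Psi> (A\<^sup>*) * (\<Psi> (A\<^sup>*))\<^sup>* = 1" if "A\<^sup>* * A = 1 \<or> A * A\<^sup>* = 1" for A
    by (rule ext) (use that in \<open>unfold adj_adj, blast\<close>)
qed (simp_all add: add scaleC ST)

text \<open>According to whether \<open>\<Psi> S\<close> is an isometry or a coisometry,
  \<open>isometric_multiplicative\<close> is applied to \<open>\<Psi>\<close> or to its pointwise
  adjoint.\<close>

lemma multiplicative_cases:
  "(\<forall>X Y. (\<Psi> X)\<^sup>* * \<Psi> Y = (\<Psi> 1)\<^sup>* * \<Psi> (X\<^sup>* * Y)) \<and> (\<Psi> 1)\<^sup>* * \<Psi> 1 = 1 \<or>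
    (\<forall>X Y. \<Psi> X * (\<Psi> Y)\<^sup>* = \<Psi> 1 * (\<Psi> (X\<^sup>* * Y))\<^sup>*) \<and> \<Psi> 1 * (\<Psi> 1)\<^sup>* = 1"
proof -
  interpret d: extreme_preserver "\<lambda>A. (\<Psi> A)\<^sup>*" "cnj \<circ> \<sigma>" S T by (rule extreme_preserver_adj)
  show ?thesis
  proof (cases "(\<Psi> S)\<^sup>* * \<Psi> S = 1")
    case True
    then show ?thesis using isometric_multiplicative by blast
  next
    case False
    then have "((\<Psi> S)\<^sup>*)\<^sup>* * (\<Psi> S)\<^sup>* = 1" using ext [of S] ST by simp
    from d.isometric_multiplicative [OF this] show ?thesis by simp
  qed
qed

text \<open>If isometries and coisometries were both mapped to isometries, then the functional
  \<open>A \<mapsto> (\<Psi> 1)\<^sup>* * \<Psi> A\<close> would be a trace, which is impossible because \<open>1 = S\<^sup>* * S = T\<^sup>* * T\<close>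
  and \<open>1 = S * S\<^sup>* + T * T\<^sup>*\<close>.\<close>

lemma multiplicative_imp_unitary:
  assumes mult: "\<And>X Y. (\<Psi> X)\<^sup>* * \<Psi> Y = (\<Psi> 1)\<^sup>* * \<Psi> (X\<^sup>* * Y)" and one: "(\<Psi> 1)\<^sup>* * \<Psi> 1 = 1"
  shows "\<Psi> 1 * (\<Psi> 1)\<^sup>* = 1"
proof -
  interpret d: extreme_preserver "\<lambda>A. \<Psi> (A\<^sup>*)" "\<sigma> \<circ> cnj" S T by (rule extreme_preserver_comp_adj)
  from d.multiplicative_cases show ?thesis
  proof
    assume "(\<forall>X Y. (\<Psi> (X\<^sup>*))\<^sup>* * \<Psi> (Y\<^sup>*) = (\<Psi> (1\<^sup>*))\<^sup>* * \<Psi> ((X\<^sup>* * Y)\<^sup>*)) \<and> (\<Psi> (1\<^sup>*))\<^sup>* * \<Psi> (1\<^sup>*) = 1"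
    then have mult': "(\<Psi> X)\<^sup>* * \<Psi> X = (\<Psi> 1)\<^sup>* * \<Psi> (X * X\<^sup>*)" for X
      by (metis adj_adj adj_simps(6,7))
    have "(\<Psi> 1)\<^sup>* * \<Psi> (S * S\<^sup>*) = 1" "(\<Psi> 1)\<^sup>* * \<Psi> (T * T\<^sup>*) = 1"
      unfolding mult' [symmetric] using mult [of S S] mult [of T T] by (simp_all only: ST one)
    then have "(\<Psi> 1)\<^sup>* * \<Psi> (S * S\<^sup>* + T * T\<^sup>*) = 1 + 1" by (simp add: add distrib_left)
    then have "(1 :: 'a bop) = 0" by (simp add: ST one)
    then show ?thesis by (metis mult_1 mult_zero_left)
  qed simp
qed

end

subsection \<open>Surjective star-homomorphisms\<close>

text \<open>Together with \<open>one\<close>, the single law \<open>adj_mult\<close> contains both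
  multiplicativity and preservation of adjoints.\<close>

locale star_epimorphism = semilinear_bop_map \<pi> \<sigma>
  for \<pi> :: "'a::complex_hilbert_space bop \<Rightarrow> 'a bop" and \<sigma> +
  assumes one: "\<pi> 1 = 1"
    and adj_mult: "\<pi> (X\<^sup>* * Y) = (\<pi> X)\<^sup>* * \<pi> Y"
    and surj: "surj \<pi>"
begin

lemma adj: "\<pi> (X\<^sup>*) = (\<pi> X)\<^sup>*"
  using adj_mult [of X 1] by (simp add: one)

lemma mult: "\<pi> (X * Y) = \<pi> X * \<pi> Y"
  using adj_mult [of "X\<^sup>*" Y] by (simp add: adj)

text \<open>The bound is automatic: \<open>Y\<close> is the mean of a unitary and its adjoint, and
  the image of the unitary is an isometry.\<close>

lemma norm_self_adjoint_le:
  assumes Y: "Y\<^sup>* = Y" "norm Y \<le> 1"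
  shows "norm (\<pi> Y) \<le> 1"
proof -
  obtain U where U: "U\<^sup>* * U = 1" "Y = (1/2) *\<^sub>R (U + U\<^sup>*)"
    using self_adjoint_contraction_eq_mean [OF Y] by metis
  have "norm (\<pi> U) \<le> 1"
    by (rule norm_isometry) (simp add: U one flip: adj_mult)
  then have "norm (\<pi> U + (\<pi> U)\<^sup>*) \<le> 2"
    by (intro norm_triangle_le) simp
  then show ?thesis by (simp add: U(2) scaleR add adj)
qed

text \<open>Projections lift: take a self-adjoint preimage \<open>D\<close> of a positive multiple \<open>c\<close> of the symmetry \<open>2p - 1\<close>.
  As \<open>\<pi>\<close> maps \<open>\<bar>D\<bar>\<close> to \<open>c\<close>, it maps the projection onto the kernel of \<open>\<bar>D\<bar> - D\<close> to \<open>p\<close>.\<close>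

lemma projection_lift:
  assumes p: "p\<^sup>* = p" "p * p = p"
  obtains Q where "Q\<^sup>* = Q" "Q * Q = Q" "\<pi> Q = p"
proof -
  obtain A0 where A0: "\<pi> A0 = p" using surj by (metis surjD)
  define A where "A = (1/2) *\<^sub>R (A0 + A0\<^sup>*)"
  have A: "A\<^sup>* = A" "\<pi> A = p"
    by (simp_all add: A_def add.commute scaleR add adj A0 p flip: scaleR_2)
  define c where "c = 1 / (norm (2 *\<^sub>R A - 1) + 1)"
  have c: "0 < c" by (simp add: c_def add_nonneg_pos)
  define D where "D = c *\<^sub>R (2 *\<^sub>R A - 1)"
  have D: "D\<^sup>* = D" by (simp add: D_def A)
  have nD: "norm D \<le> 1" using c by (simp add: D_def c_def)
  have \<pi>D: "\<pi> D = c *\<^sub>R (2 *\<^sub>R p - 1)" by (simp add: D_def scaleR diff A one)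
  have "norm (1 - D * D) \<le> 1"
  proof (rule norm_bop_le)
    fix x
    have "\<langle>x, D \<cdot> (D \<cdot> x)\<rangle> = \<langle>D \<cdot> x, D \<cdot> x\<rangle>" using cinner_adj_left [of D x "D \<cdot> x"] by (simp add: D)
    then have "(norm ((1 - D * D) \<cdot> x))\<^sup>2 = (norm x)\<^sup>2 + (norm (D \<cdot> (D \<cdot> x)))\<^sup>2 - 2 * (norm (D \<cdot> x))\<^sup>2"
      by (simp add: norm_diff_square cinner_self)
    also have "(norm (D \<cdot> (D \<cdot> x)))\<^sup>2 \<le> (norm (D \<cdot> x))\<^sup>2"
      by (intro power_mono norm_bop_apply_le nD) simp
    finally have "(norm ((1 - D * D) \<cdot> x))\<^sup>2 \<le> (norm x)\<^sup>2" using zero_le_power2 [of "norm (D \<cdot> x)"] by linarith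
    then show "norm ((1 - D * D) \<cdot> x) \<le> 1 * norm x" unfolding mult_1 by (rule power2_le_imp_le) simp
  qed simp
  moreover have "(1 - D * D)\<^sup>* = 1 - D * D" by (simp add: D)
  ultimately obtain Y where Y: "Y\<^sup>* = Y" "norm Y \<le> 1" "(1 - Y) * (1 - Y) = 1 - (1 - D * D)"
    and com: "\<And>C. C * (1 - D * D) = (1 - D * D) * C \<Longrightarrow> C * Y = Y * C"
    using square_root_exists by metis
  define R where "R = 1 - Y"
  have R: "R\<^sup>* = R" "R * R = D * D" using Y by (simp_all add: R_def)
  have DR: "D * R = R * D" using com [of D] by (simp add: R_def algebra_simps)
  \<comment> \<open>\<open>\<pi> R\<close> squares to \<open>(c * c) *\<^sub>R 1\<close>, and it
    cannot have the eigenvalue \<open>- c\<close>: as \<open>R = 1 - Y\<close> and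
    \<open>\<pi> Y\<close> is a contraction, its quadratic form has nonnegative real part.\<close>
  have \<pi>R: "\<pi> R = c *\<^sub>R 1"
  proof (rule bop_eqI)
    fix x
    define r where "r = \<pi> R"
    have "(2 *\<^sub>R p - 1) * (2 *\<^sub>R p - 1) = 1" by (simp add: p algebra_simps flip: scaleR_add_left)
    then have "\<pi> D * \<pi> D = (c * c) *\<^sub>R 1" by (simp add: \<pi>D)
    then have rr: "r * r = (c * c) *\<^sub>R 1" unfolding r_def mult [symmetric] R .
    define z where "z = (r - c *\<^sub>R 1) \<cdot> x"
    have "(r + c *\<^sub>R 1) * (r - c *\<^sub>R 1) = 0" by (simp add: algebra_simps rr)
    then have "(r + c *\<^sub>R 1) \<cdot> z = 0" unfolding z_def by (metis bop_apply_simps(1,7))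
    then have rz: "r \<cdot> z = - (c *\<^sub>R z)" by (simp add: eq_neg_iff_add_eq_0)
    have "norm (\<pi> Y) \<le> 1" by (rule norm_self_adjoint_le) (fact Y)+
    then have "cmod \<langle>\<pi> Y \<cdot> z, z\<rangle> \<le> norm z * norm z"
      using order_trans [OF cinner_Cauchy_Schwarz mult_right_mono [OF norm_bop_apply_le]] by simp
    then have "Re \<langle>\<pi> Y \<cdot> z, z\<rangle> \<le> norm z * norm z" using complex_Re_le_cmod order_trans by blast
    moreover have "Re \<langle>r \<cdot> z, z\<rangle> = norm z * norm z - Re \<langle>\<pi> Y \<cdot> z, z\<rangle>"
      by (simp add: r_def R_def diff one cinner_simps cinner_self power2_eq_square)
    moreover have "Re \<langle>r \<cdot> z, z\<rangle> = - (c * (norm z * norm z))"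
      by (simp add: rz cinner_simps cinner_self power2_eq_square)
    ultimately have "c * (norm z * norm z) \<le> 0" by linarith
    then have "z = 0" using c by (simp add: mult_le_0_iff)
    then show "\<pi> R \<cdot> x = (c *\<^sub>R 1) \<cdot> x" by (simp add: z_def r_def)
  qed
  define N where "N = R - D"
  define P where "P = R + D"
  have \<pi>N: "\<pi> N = (2 * c) *\<^sub>R (1 - p)" and \<pi>P: "\<pi> P = (2 * c) *\<^sub>R p"
    by (simp_all add: N_def P_def diff add \<pi>R \<pi>D algebra_simps flip: scaleR_2)
  have NP: "N * P = 0" by (simp add: N_def P_def algebra_simps R DR)
  define K where "K = {x. N \<cdot> x = 0}"
  have K: "complex_vector.subspace K"
    by (auto simp: K_def complex_vector.subspace_def bop_apply_linear)
  have "closed K"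
    unfolding K_def
    by (intro closed_Collect_eq bounded_linear.continuous_on [OF bounded_linear_bop_apply]
        continuous_intros)
  obtain Q where Q: "Q\<^sup>* = Q" "Q * Q = Q" "\<And>x. Q \<cdot> x \<in> K" "\<And>x. x \<in> K \<Longrightarrow> Q \<cdot> x = x"
    using closed_subspace_projection [OF K \<open>closed K\<close>] by metis
  \<comment> \<open>\<open>Q\<close> fixes the range of \<open>P\<close>, and \<open>N\<close>
    vanishes on the range of \<open>Q\<close>; under \<open>\<pi>\<close> these facts say that
    \<open>p\<close> lies below and above \<open>\<pi> Q\<close>.\<close>
  have "N \<cdot> (P \<cdot> x) = 0" for x using NP by (metis bop_apply_simps(1,7))
  then have "Q * P = P" by (intro bop_eqI) (simp add: Q(4) K_def)
  then have "\<pi> Q * \<pi> P = \<pi> P" by (simp flip: mult)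
  then have "\<pi> Q * p = p" using c by (simp add: \<pi>P)
  then have "(\<pi> Q * p)\<^sup>* = p\<^sup>*" by simp
  then have pQ: "p * \<pi> Q = p" by (simp add: p Q flip: adj)
  have "N * Q = 0" using Q(3) by (intro bop_eqI) (simp add: K_def)
  then have "\<pi> N * \<pi> Q = 0" by (simp add: zero flip: mult)
  then have "(1 - p) * \<pi> Q = 0" using c by (simp add: \<pi>N)
  then have "\<pi> Q = p" using pQ by (simp add: algebra_simps)
  with Q that show ?thesis by metis
qed

lemma rank_one_not_in_kernel:
  assumes nz: "\<exists>x::'a. x \<noteq> 0"
  obtains f where "\<langle>f, f\<rangle> = 1" "\<pi> (rank_one f f) \<noteq> 0"
proof -
  obtain x :: 'a where "x \<noteq> 0" using nz by blast
  define e where "e = inverse (norm x) *\<^sub>R x"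
  have ee: "\<langle>e, e\<rangle> = 1" unfolding e_def by (rule cinner_normalize [OF \<open>x \<noteq> 0\<close>])
  define p where "p = rank_one e e"
  have p: "p\<^sup>* = p" "p * p = p" by (simp_all add: p_def rank_one_simps ee scaleC_one)
  have pe: "p \<cdot> y = \<langle>y, e\<rangle> *\<^sub>C e" for y by (simp add: p_def)
  obtain Q where Q: "Q\<^sup>* = Q" "Q * Q = Q" "\<pi> Q = p" using projection_lift [OF p] by metis
  obtain B where B: "orthonormal B" "\<And>b. b \<in> B \<Longrightarrow> Q \<cdot> b = b"
    "\<And>x. (\<And>b. b \<in> B \<Longrightarrow> \<langle>x, b\<rangle> = 0) \<Longrightarrow> Q \<cdot> x = 0"
    using orthonormal_basis_of_projection [OF Q(1,2)] by metis
  have "finite B"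
  proof (rule ccontr)
    assume "infinite B"
    then obtain V W where VW: "V\<^sup>* * V = Q" "W\<^sup>* * W = Q" "V\<^sup>* * W = 0" "V * V\<^sup>* + W * W\<^sup>* = Q"
      using halve_projection [OF B(1) B(2,3)] by metis
    define v where "v = \<pi> V"
    define w where "w = \<pi> W"
    have vw: "v\<^sup>* * v = p" "w\<^sup>* * w = p" "v\<^sup>* * w = 0" "v * v\<^sup>* + w * w\<^sup>* = p"
      unfolding v_def w_def adj [symmetric] mult [symmetric] add [symmetric] VW by (simp_all add: Q zero)
    have wv: "w\<^sup>* * v = 0" using arg_cong [OF vw(3), of adj] by simp
    \<comment> \<open>Multiplying \<open>v * v\<^sup>* + w * w\<^sup>* = p\<close> by
      \<open>v\<close> and \<open>w\<close> gives commutation with \<open>p\<close>, so both map the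
      line through \<open>e\<close> into itself. Yet \<open>v \<cdot> e\<close> and
      \<open>w \<cdot> e\<close> are orthonormal.\<close>
    have "p * v = v * p" "p * w = w * p"
      unfolding vw(4) [symmetric] by (simp_all add: distrib_right mult.assoc vw(1-3) wv) (simp_all add: vw(4))
    then have "p \<cdot> (v \<cdot> e) = v \<cdot> e" "p \<cdot> (w \<cdot> e) = w \<cdot> e"
      by (simp_all add: pe ee scaleC_one flip: bop_apply_simps(7)) (simp_all add: pe ee scaleC_one)
    then obtain a b where ab: "v \<cdot> e = a *\<^sub>C e" "w \<cdot> e = b *\<^sub>C e" unfolding pe by metis
    have "\<langle>v \<cdot> e, v \<cdot> e\<rangle> = 1" "\<langle>w \<cdot> e, w \<cdot> e\<rangle> = 1" "\<langle>w \<cdot> e, v \<cdot> e\<rangle> = 0"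
      unfolding cinner_adj_left [symmetric] bop_apply_simps(7) [symmetric] vw
      by (simp_all add: pe ee scaleC_one)
    then show False unfolding ab by (auto simp: cinner_simps ee)
  qed
  \<comment> \<open>For a finite sum additivity suffices, and since \<open>p\<close> is nonzero some
    summand is.\<close>
  then have "p = (\<Sum>b\<in>B. \<pi> (rank_one b b))"
    using finite_projection_eq_sum [OF B(1) _ B(2,3)] Q(3) sum [of "\<lambda>b. rank_one b b" B] by metis
  moreover have "p \<noteq> 0" using pe [of e] ee by (auto simp: scaleC_one)
  ultimately have "(\<Sum>b\<in>B. \<pi> (rank_one b b)) \<noteq> 0" by simp
  then obtain f where "f \<in> B" "\<pi> (rank_one f f) \<noteq> 0"
    by (rule sum.not_neutral_contains_not_neutral)
  then show ?thesis using that [of f] orthonormalD [OF B(1)] by simp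
qed

text \<open>The intertwining relation is multiplicativity of \<open>\<pi>\<close>. \<open>V\<close>
  preserves norms because the adjoint of \<open>rank_one x f\<close> times
  \<open>rank_one x f\<close> is a multiple of \<open>rank_one f f\<close>, whose image fixes
  \<open>g\<close>.\<close>

lemma spatial:
  assumes nz: "\<exists>x::'a. x \<noteq> 0"
  obtains V where "\<And>x y. V (x + y) = V x + V y" "\<And>c x. V (c *\<^sub>C x) = \<sigma> c *\<^sub>C V x"
    "\<And>x. norm (V x) = norm x" "bij V" "\<And>A x. \<pi> A \<cdot> V x = V (A \<cdot> x)"
proof -
  obtain f where ff: "\<langle>f, f\<rangle> = 1" and "\<pi> (rank_one f f) \<noteq> 0"
    using rank_one_not_in_kernel [OF nz] by metis
  then obtain h where h: "\<pi> (rank_one f f) \<cdot> h \<noteq> 0" by (metis bop_eqI bop_apply_simps(1))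
  define g where "g = inverse (norm (\<pi> (rank_one f f) \<cdot> h)) *\<^sub>R (\<pi> (rank_one f f) \<cdot> h)"
  have gg: "\<langle>g, g\<rangle> = 1" unfolding g_def by (rule cinner_normalize [OF h])
  have "rank_one f f * rank_one f f = rank_one f f" by (simp add: rank_one_simps ff scaleC_one)
  then have fg: "\<pi> (rank_one f f) \<cdot> g = g"
    by (simp add: g_def bop_apply_linear flip: bop_apply_simps(7) mult)
  define V where "V x = \<pi> (rank_one x f) \<cdot> g" for x
  have V: "V (x + y) = V x + V y" "V (c *\<^sub>C x) = \<sigma> c *\<^sub>C V x" for x y c
    by (simp_all add: V_def rank_one_simps add scaleC)
  have VA: "\<pi> A \<cdot> V x = V (A \<cdot> x)" for A x
    by (simp add: V_def flip: bop_apply_simps(7) mult) (simp add: rank_one_simps)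
  have "\<langle>V x, V x\<rangle> = \<langle>x, x\<rangle>" for x
  proof -
    have "\<langle>V x, V x\<rangle> = \<langle>\<pi> ((rank_one x f)\<^sup>* * rank_one x f) \<cdot> g, g\<rangle>"
      by (simp only: V_def mult adj bop_apply_simps cinner_adj_left)
    moreover have "(rank_one x f)\<^sup>* * rank_one x f = \<langle>x, x\<rangle> *\<^sub>C rank_one f f"
      by (simp add: rank_one_simps)
    moreover have "\<sigma> \<langle>x, x\<rangle> = \<langle>x, x\<rangle>" unfolding cinner_self by (rule \<sigma>_simps)
    ultimately show ?thesis by (simp add: scaleC fg cinner_simps gg)
  qed
  then have normV: "norm (V x) = norm x" for x
    unfolding cinner_self of_real_eq_iff by (simp add: power2_eq_iff_nonneg)
  have "inj V"
  proof (rule injI)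
    fix x y assume "V x = V y"
    then have "V (x - y) = 0" using V(1) [of "x - y" y] by simp
    then have "norm (x - y) = 0" using normV [of "x - y"] by simp
    then show "x = y" by simp
  qed
  moreover have "surj V"
    unfolding surj_def
  proof
    fix y
    \<comment> \<open>The operator \<open>rank_one y (V f)\<close> carries \<open>V f\<close> to
      \<open>y\<close>, so by intertwining its preimage shows \<open>y\<close> to be in the range of
      \<open>V\<close>.\<close>
    obtain A where A: "\<pi> A = rank_one y (V f)" using surj by (metis surjD)
    have "\<langle>V f, V f\<rangle> = 1" using ff by (simp add: cinner_self normV)
    then have "y = V (A \<cdot> f)" by (simp add: A scaleC_one flip: VA)
    then show "\<exists>x. y = V x" ..
  qed
  ultimately show ?thesis using that [OF V normV _ VA] by (simp add: bij_def)
qed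

end

context extreme_preserver
begin

text \<open>The unitary \<open>W = \<Psi> 1\<close> is divided out to reach a star-epimorphism. The
  last relation serves the case in which \<open>\<Psi>\<close> is the pointwise adjoint of the given
  map.\<close>

lemma spatial_implementation:
  assumes mult: "\<And>X Y. (\<Psi> X)\<^sup>* * \<Psi> Y = (\<Psi> 1)\<^sup>* * \<Psi> (X\<^sup>* * Y)" and one: "(\<Psi> 1)\<^sup>* * \<Psi> 1 = 1"
    and surj: "surj \<Psi>" and nz: "\<exists>x::'a. x \<noteq> 0"
  obtains W V where "W\<^sup>* * W = 1" "W * W\<^sup>* = 1"
    "\<And>x y. V (x + y) = V x + V y" "\<And>c x. V (c *\<^sub>C x) = \<sigma> c *\<^sub>C V x" "\<And>x. norm (V x) = norm x" "bij V"
    "\<And>A x. \<Psi> A \<cdot> V x = W \<cdot> V (A \<cdot> x)" "\<And>A x. (\<Psi> A)\<^sup>* \<cdot> (W \<cdot> V x) = V (A\<^sup>* \<cdot> x)"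
proof -
  define W where "W = \<Psi> 1"
  have W: "W\<^sup>* * W = 1" "W * W\<^sup>* = 1"
    using one multiplicative_imp_unitary [OF mult one] by (simp_all add: W_def)
  have WW: "W * (W\<^sup>* * A) = A" for A using W by (simp flip: mult.assoc)
  define \<pi> where "\<pi> A = W\<^sup>* * \<Psi> A" for A
  interpret \<pi>: star_epimorphism \<pi> \<sigma>
  proof
    show "\<pi> (X\<^sup>* * Y) = (\<pi> X)\<^sup>* * \<pi> Y" for X Y
    proof -
      have "(\<pi> X)\<^sup>* * \<pi> Y = (\<Psi> X)\<^sup>* * \<Psi> Y" by (simp add: \<pi>_def WW mult.assoc)
      also have "\<dots> = \<pi> (X\<^sup>* * Y)" unfolding \<pi>_def W_def by (rule mult)
      finally show ?thesis ..
    qed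
    show "surj \<pi>"
      unfolding surj_def
    proof
      fix B
      obtain A where "\<Psi> A = W * B" using surj by (metis surjD)
      then have "B = \<pi> A" using W by (simp add: \<pi>_def flip: mult.assoc)
      then show "\<exists>A. B = \<pi> A" ..
    qed
  qed (use W \<sigma> in \<open>auto simp: \<pi>_def W_def add scaleC distrib_left\<close>)
  obtain V where V: "\<And>x y. V (x + y) = V x + V y" "\<And>c x. V (c *\<^sub>C x) = \<sigma> c *\<^sub>C V x"
    "\<And>x. norm (V x) = norm x" "bij V" and \<pi>V: "\<And>A x. \<pi> A \<cdot> V x = V (A \<cdot> x)"
    using \<pi>.spatial [OF nz] by metis
  have "\<Psi> A = W * \<pi> A" for A by (simp add: \<pi>_def WW)
  then have "\<Psi> A \<cdot> V x = W \<cdot> V (A \<cdot> x)" for A x by (simp add: \<pi>V)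
  moreover have "(\<Psi> A)\<^sup>* * W = \<pi> (A\<^sup>*)" for A unfolding \<pi>.adj by (simp add: \<pi>_def)
  then have "(\<Psi> A)\<^sup>* \<cdot> (W \<cdot> V x) = V (A\<^sup>* \<cdot> x)" for A x by (metis \<pi>V bop_apply_simps(7))
  ultimately show ?thesis using that W V by blast
qed

end

subsection \<open>The characterization\<close>

lemma linear_scaleC_D:
  assumes "Vector_Spaces.linear scaleC scaleC f"
  shows "f (x + y) = f x + f y" "f (c *\<^sub>C x) = c *\<^sub>C f x"
proof -
  interpret Vector_Spaces.linear scaleC scaleC f by (rule assms)
  show "f (x + y) = f x + f y" "f (c *\<^sub>C x) = c *\<^sub>C f x" by (rule add scale)+
qed

lemma unitary_iff: "unitary U \<longleftrightarrow> U\<^sup>* * U = 1 \<and> U * U\<^sup>* = 1"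
  by (simp add: unitary_def bop_comp_eq_times one_bop_def)

lemma surjective_isometry_imp_unitary:
  assumes "\<And>x. norm (U \<cdot> x) = norm x" "surj (bop_apply U)"
  shows "U\<^sup>* * U = 1 \<and> U * U\<^sup>* = 1"
proof -
  have U: "U\<^sup>* * U = 1" using assms by (simp add: isometry_iff)
  have "U * U\<^sup>* = 1"
  proof (rule bop_eqI)
    fix y
    obtain x where "y = U \<cdot> x" using assms(2) by (metis surjD)
    moreover have "U\<^sup>* \<cdot> (U \<cdot> x) = x" using U by (metis bop_apply_simps(2,7))
    ultimately show "(U * U\<^sup>*) \<cdot> y = 1 \<cdot> y" by simp
  qed
  with U show ?thesis ..
qed

text \<open>By surjectivity every perturbation of \<open>\<Phi> A\<close> is the image of a
  perturbation of \<open>A\<close>, and the norms agree.\<close>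

lemma norm_preserving_imp_preserves_extreme_points:
  fixes \<Phi> :: "'a::complex_inner bop \<Rightarrow> 'a bop"
  assumes \<Phi>: "Vector_Spaces.linear scaleC scaleC \<Phi>" and "surj \<Phi>" and norm: "\<And>A. norm (\<Phi> A) = norm A"
  shows "preserves_extreme_points \<Phi>"
  unfolding preserves_extreme_points_def extreme_point_of_unit_ball_iff
proof (intro allI impI conjI)
  note lin = linear_scaleC_D [OF \<Phi>]
  fix A C :: "'a bop"
  assume A: "norm A \<le> 1 \<and> (\<forall>C. norm (A + C) \<le> 1 \<longrightarrow> norm (A - C) \<le> 1 \<longrightarrow> C = 0)"
  then show "norm (\<Phi> A) \<le> 1" by (simp add: norm)
  assume C: "norm (\<Phi> A + C) \<le> 1" "norm (\<Phi> A - C) \<le> 1"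
  obtain C' where C': "C = \<Phi> C'" using \<open>surj \<Phi>\<close> by (metis surjD)
  have "\<Phi> (A - C') + \<Phi> C' = \<Phi> A" by (simp flip: lin)
  then have "\<Phi> A - C = \<Phi> (A - C')" unfolding C' by (metis add_diff_cancel_right')
  moreover have "\<Phi> A + C = \<Phi> (A + C')" by (simp add: C' lin)
  ultimately have "norm (A + C') \<le> 1" "norm (A - C') \<le> 1" using C norm by simp_all
  then have "C' = 0" using A by blast
  then show "C = 0" using norm [of 0] by (simp add: C')
qed

theorem corollary1:
  fixes \<Phi> :: "'h::complex_hilbert_space bop \<Rightarrow> 'h bop"
  assumes "\<nexists>S :: 'h set. finite S \<and> complex_vector.span S = UNIV"
    and "Vector_Spaces.linear scaleC scaleC \<Phi>"
    and "surj \<Phi>"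
  shows "preserves_extreme_points \<Phi> \<longleftrightarrow>
    (\<exists>U V :: 'h bop. unitary U \<and> unitary V \<and> (\<forall>A. \<Phi> A = U \<circ>\<^sub>B A \<circ>\<^sub>B V)) \<or>
    (\<exists>U' V' :: 'h \<Rightarrow> 'h. antiunitary U' \<and> antiunitary V' \<and>
      (\<forall>A. bop_apply (\<Phi> A) = U' \<circ> bop_apply (A\<^sup>*) \<circ> V'))"
    (is "_ \<longleftrightarrow> ?unitary \<or> ?antiunitary")
proof
  assume ext: "preserves_extreme_points \<Phi>"
  note lin = linear_scaleC_D [OF assms(2)]
  obtain S T :: "'h bop" where ST: "S\<^sup>* * S = 1" "T\<^sup>* * T = 1" "S\<^sup>* * T = 0" "S * S\<^sup>* + T * T\<^sup>* = 1"
    using infinite_dimensional_halving [OF assms(1)] by metis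
  interpret \<Phi>: extreme_preserver \<Phi> "\<lambda>c. c" S T
  proof
    show "(\<Phi> A)\<^sup>* * \<Phi> A = 1 \<or> \<Phi> A * (\<Phi> A)\<^sup>* = 1" if "A\<^sup>* * A = 1 \<or> A * A\<^sup>* = 1" for A
      using ext that unfolding preserves_extreme_points_def extreme_point_bop_iff by blast
  qed (simp_all add: lin ST)
  have nz: "\<exists>x::'h. x \<noteq> 0"
  proof (rule ccontr)
    assume "\<not> ?thesis"
    then have "complex_vector.span {} = (UNIV :: 'h set)" by auto
    then show False using assms(1) by blast
  qed
  from \<Phi>.multiplicative_cases show "?unitary \<or> ?antiunitary"
  proof
    assume *: "(\<forall>X Y. (\<Phi> X)\<^sup>* * \<Phi> Y = (\<Phi> 1)\<^sup>* * \<Phi> (X\<^sup>* * Y)) \<and> (\<Phi> 1)\<^sup>* * \<Phi> 1 = 1"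
    obtain W V where W: "W\<^sup>* * W = 1" "W * W\<^sup>* = 1"
      and V: "\<And>x y. V (x + y) = V x + V y" "\<And>c x. V (c *\<^sub>C x) = c *\<^sub>C V x" "\<And>x. norm (V x) = norm x" "bij V"
      and \<Phi>V: "\<And>A x. \<Phi> A \<cdot> V x = W \<cdot> V (A \<cdot> x)"
      using \<Phi>.spatial_implementation [OF _ _ assms(3) nz] * by metis
    obtain U where U: "\<And>x. U \<cdot> x = V x"
      using bop_exists [of V 1] V by auto
    have "surj V" using V(4) by (rule bij_is_surj)
    then have U1: "U\<^sup>* * U = 1 \<and> U * U\<^sup>* = 1"
      by (intro surjective_isometry_imp_unitary) (simp_all add: U V surj_def)
    have "\<Phi> A * U = W * U * A" for A by (rule bop_eqI) (simp add: U \<Phi>V)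
    then have "\<Phi> A = W * U * A * U\<^sup>*" for A using U1 by (metis mult.assoc mult_1_right)
    moreover have "unitary (W * U)"
      using U1 W by (simp add: unitary_iff mult.assoc) (metis mult.assoc mult_1_left)
    moreover have "unitary (U\<^sup>*)" using U1 by (simp add: unitary_iff)
    ultimately show ?thesis by (auto simp: bop_comp_eq_times)
  next
    assume *: "(\<forall>X Y. \<Phi> X * (\<Phi> Y)\<^sup>* = \<Phi> 1 * (\<Phi> (X\<^sup>* * Y))\<^sup>*) \<and> \<Phi> 1 * (\<Phi> 1)\<^sup>* = 1"
    \<comment> \<open>The pointwise adjoint of \<open>\<Phi>\<close> satisfies the isometric
      relation and is conjugate-linear, so the implementing \<open>V\<close> will be
      antiunitary.\<close>
    interpret \<Psi>: extreme_preserver "\<lambda>A. (\<Phi> A)\<^sup>*" cnj S T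
      using \<Phi>.extreme_preserver_adj unfolding comp_def .
    have mult: "((\<Phi> X)\<^sup>*)\<^sup>* * (\<Phi> Y)\<^sup>* = ((\<Phi> 1)\<^sup>*)\<^sup>* * (\<Phi> (X\<^sup>* * Y))\<^sup>*" for X Y
      unfolding adj_adj by (rule conjunct1 [OF *, rule_format])
    have one: "((\<Phi> 1)\<^sup>*)\<^sup>* * (\<Phi> 1)\<^sup>* = 1" unfolding adj_adj by (rule conjunct2 [OF *])
    have surj: "surj (\<lambda>A. (\<Phi> A)\<^sup>*)"
      using assms(3) unfolding surj_def by (metis adj_adj)
    obtain W V where W: "W\<^sup>* * W = 1" "W * W\<^sup>* = 1"
      and V: "\<And>x y. V (x + y) = V x + V y" "\<And>c x. V (c *\<^sub>C x) = cnj c *\<^sub>C V x" "\<And>x. norm (V x) = norm x" "bij V"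
      and \<Phi>V: "\<And>A x. \<Phi> A \<cdot> (W \<cdot> V x) = V (A\<^sup>* \<cdot> x)"
      using \<Psi>.spatial_implementation [OF mult one surj nz, unfolded adj_adj] by metis
    \<comment> \<open>\<open>V'\<close> inverts \<open>x \<mapsto> W \<cdot> V x\<close>, the map on
      whose values \<open>\<Phi> A\<close> is known.\<close>
    define V' where "V' x = inv V (W\<^sup>* \<cdot> x)" for x
    have VV': "V (V' x) = W\<^sup>* \<cdot> x" for x
      by (simp add: V'_def surj_f_inv_f bij_is_surj V)
    have V_eq: "x = y" if "V x = V y" for x y
      using that V(4) by (simp add: bij_is_inj inj_eq)
    have WW: "W \<cdot> (W\<^sup>* \<cdot> x) = x" "W\<^sup>* \<cdot> (W \<cdot> x) = x" for x
      using W by (metis bop_apply_simps(2,7))+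
    have "antiunitary V" unfolding antiunitary_def using V by blast
    moreover have "V' (x + y) = V' x + V' y" for x y
      by (rule V_eq) (simp only: VV' V(1) bop_apply_linear)
    moreover have "V' (a *\<^sub>C x) = cnj a *\<^sub>C V' x" for a x
      by (rule V_eq) (simp only: VV' V(2) bop_apply_linear complex_cnj_cnj)
    moreover have "norm (V' x) = norm x" for x
    proof -
      have "norm (V' x) = norm (W\<^sup>* \<cdot> x)" using V(3) [of "V' x"] by (simp only: VV')
      also have "\<dots> = norm x" using W isometry_iff [of "W\<^sup>*"] by simp
      finally show ?thesis .
    qed
    moreover have "bij V'"
    proof (rule bij_betw_byWitness [where f' = "\<lambda>x. W \<cdot> V x"])
      show "\<forall>x\<in>UNIV. W \<cdot> V (V' x) = x" by (simp only: VV' WW) simp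
      show "\<forall>x\<in>UNIV. V' (W \<cdot> V x) = x" using V(4) by (simp add: V'_def WW bij_is_inj)
    qed simp_all
    ultimately have "antiunitary V" "antiunitary V'" by (simp_all only: antiunitary_def simp_thms)
    moreover have "bop_apply (\<Phi> A) = V \<circ> bop_apply (A\<^sup>*) \<circ> V'" for A
    proof
      fix x
      have "\<Phi> A \<cdot> x = \<Phi> A \<cdot> (W \<cdot> V (V' x))" by (simp add: VV' WW)
      then show "\<Phi> A \<cdot> x = (V \<circ> bop_apply (A\<^sup>*) \<circ> V') x" by (simp add: \<Phi>V)
    qed
    ultimately show ?thesis by blast
  qed
next
  \<comment> \<open>For the converse both forms are shown to preserve the operator norm.\<close>
  assume "?unitary \<or> ?antiunitary"
  then show "preserves_extreme_points \<Phi>"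
  proof (elim disjE exE conjE)
    fix U V assume UV: "unitary U" "unitary V" and "\<forall>A. \<Phi> A = U \<circ>\<^sub>B A \<circ>\<^sub>B V"
    then have \<Phi>: "\<Phi> A = U * A * V" for A by (simp add: bop_comp_eq_times)
    have n: "norm U \<le> 1" "norm V \<le> 1" "norm (U\<^sup>*) \<le> 1" "norm (V\<^sup>*) \<le> 1"
      using UV by (simp_all add: unitary_iff norm_isometry)
    have le: "norm (X * A * Y) \<le> norm A" if "norm X \<le> 1" "norm Y \<le> 1" for X A Y :: "'h bop"
    proof -
      have "norm (X * A * Y) \<le> norm X * norm A * norm Y"
        by (rule order_trans [OF norm_mult_ineq mult_right_mono [OF norm_mult_ineq]]) simp
      also have "\<dots> \<le> 1 * norm A * 1" using that by (intro mult_mono) auto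
      finally show ?thesis by simp
    qed
    have "norm (\<Phi> A) = norm A" for A
    proof (rule antisym)
      show "norm (\<Phi> A) \<le> norm A" unfolding \<Phi> by (rule le) (fact n)+
      have "A = (U\<^sup>* * U) * A * (V * V\<^sup>*)" using UV by (simp add: unitary_iff)
      then have "A = U\<^sup>* * \<Phi> A * V\<^sup>*" by (simp add: \<Phi> mult.assoc)
      then show "norm A \<le> norm (\<Phi> A)" using le [OF n(3,4), of "\<Phi> A"] by simp
    qed
    then show ?thesis by (rule norm_preserving_imp_preserves_extreme_points [OF assms(2,3)])
  next
    fix U V assume UV: "antiunitary U" "antiunitary V"
      and \<Phi>: "\<forall>A. bop_apply (\<Phi> A) = U \<circ> bop_apply (A\<^sup>*) \<circ> V"
    have n: "norm (\<Phi> A \<cdot> x) = norm (A\<^sup>* \<cdot> V x)" for A x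
      using UV by (simp add: \<Phi> antiunitary_def)
    have "norm (\<Phi> A) = norm A" for A
    proof (rule antisym)
      show "norm (\<Phi> A) \<le> norm A"
      proof (rule norm_bop_le)
        show "norm (\<Phi> A \<cdot> x) \<le> norm A * norm x" for x
          using norm_bop_apply [of "A\<^sup>*" "V x"] UV by (simp add: n antiunitary_def)
      qed simp
      have "norm (A\<^sup>*) \<le> norm (\<Phi> A)"
      proof (rule norm_bop_le)
        fix y
        have "V (inv V y) = y" using UV by (simp add: antiunitary_def bij_is_surj surj_f_inv_f)
        moreover from this have "norm (inv V y) = norm y" using UV by (metis antiunitary_def)
        ultimately show "norm (A\<^sup>* \<cdot> y) \<le> norm (\<Phi> A) * norm y"
          using norm_bop_apply [of "\<Phi> A" "inv V y"] by (simp add: n)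
      qed simp
      then show "norm A \<le> norm (\<Phi> A)" by simp
    qed
    then show ?thesis by (rule norm_preserving_imp_preserves_extreme_points [OF assms(2,3)])
  qed
qed

end
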